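(* The function $p\mapsto\mathrm{GP}_p$ is continuous on $[2,\infty]$ (continuity at $p=\infty$ meaning $\lim_{p\to\infty}\mathrm{GP}_p=\mathrm{GP}_\infty$).
   Context: $(g_{ij})_{i,j\ge1}$ are i.i.d. standard Gaussian random variables on one probability space, and $G_n=(g_{ij})_{i,j\in[n]}$, $[n]=\{1,\dots,n\}$. For $2\le p\le\infty$ (with $2/\infty=0$), $$\mathrm{GP}_{n,p}=\max_{x\in\mathbb{R}^n:\|x\|_p=1}\frac{\langle G_nx,x\rangle}{n^{3/2-2/p}},$$ where $\|x\|_p=(\sum_i|x_i|^p)^{1/p}$ for $p<\infty$ and $\|x\|_\infty=\max_i|x_i|$. For every $p\in[2,\infty]$, $\mathrm{GP}_{n,p}$ converges almost surely to a deterministic limit, denoted $\mathrm{GP}_p=\lim_{n\to\infty}\mathrm{GP}_{n,p}$ (for $p=2$ it equals $\sqrt2$). *)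

theory Defs
  imports "HOL-Probability.Probability"
begin

(* A vector of R^n is a function on nat of which only the coordinates 1, ..., n are used.
   All definitions below are meant for n >= 1. *)

definition lp_norm :: "nat \<Rightarrow> ereal \<Rightarrow> (nat \<Rightarrow> real) \<Rightarrow> real" where
  "lp_norm n p x =
     (if p = \<infinity> then Max ((\<lambda>i. \<bar>x i\<bar>) ` {1..n})
      else (\<Sum>i=1..n. \<bar>x i\<bar> powr real_of_ereal p) powr (1 / real_of_ereal p))"

definition quad_form :: "nat \<Rightarrow> (nat \<Rightarrow> nat \<Rightarrow> real) \<Rightarrow> (nat \<Rightarrow> real) \<Rightarrow> real" where
  "quad_form n G x = (\<Sum>i=1..n. (\<Sum>j=1..n. G i j * x j) * x i)"

(* The supremum is a maximum: the unit sphere of R^n is nonempty and compact for n >= 1.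
   In ereal, 2 / \<infinity> = 0. *)
definition GP_np :: "(nat \<Rightarrow> nat \<Rightarrow> real) \<Rightarrow> nat \<Rightarrow> ereal \<Rightarrow> real" where
  "GP_np G n p =
     (SUP x \<in> {x. lp_norm n p x = 1}.
        quad_form n G x / real n powr (3/2 - real_of_ereal (2 / p)))"

end

theory Submission
  imports Defs
begin

text \<open>With \<open>y = n powr (1/p) * x\<close>, \<open>GP_np\<close> is \<open>n powr (- 3/2)\<close> times the maximum of the quadratic form over
  the ball on which \<open>|y i| powr p\<close> has mean at most 1. These balls shrink as \<open>p\<close> grows, so the limit is
  antitone and only sudden drops must be excluded.

  For \<open>p > 2\<close>, cut a near-optimal \<open>y\<close> at a level \<open>K\<close>. The part above \<open>K\<close> has Euclidean norm
  at most \<open>K powr ((2 - p) / 2) * sqrt n\<close>, hence contributes little by the bound on the operator norm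
  that the convergence at \<open>p = 2\<close> gives for \<open>G\<close> and, by symmetry, for \<open>- G\<close>. The part below \<open>K\<close> lies in the
  \<open>q\<close>-ball up to the factor \<open>K powr (1 - p/q)\<close>, which tends to 1 as \<open>q\<close> and \<open>p\<close> get close.

  For \<open>p = 2\<close> this fails. There, rotation invariance of the law of \<open>G\<close> lets one replace an optimal vector by
  its image under a randomly signed Hadamard matrix of order \<open>n = 2 ^ k\<close>, whose coordinates are Rademacher
  sums with bounded fourth moments; so its \<open>q\<close>-norm is almost the Euclidean one when \<open>q\<close> is
  close to 2. A probability bounded away from 0 suffices because the limits are constants.\<close>

subsection \<open>Rotation invariance of the standard Gaussian law\<close>

definition stdn :: "real measure" where
  "stdn = density lborel (\<lambda>x. ennreal (std_normal_density x))"

text \<open>The canonical law. All invariance arguments take place on this product space; the random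
  matrix of the theorem enters only through its law, in \<open>prob_exceeds\<close>.\<close>

definition gauss :: "'i set \<Rightarrow> ('i \<Rightarrow> real) measure" where
  "gauss I = PiM I (\<lambda>_. stdn)"

definition preserves :: "'a measure \<Rightarrow> ('a \<Rightarrow> 'a) \<Rightarrow> bool" where
  "preserves P S \<longleftrightarrow> S \<in> measurable P P \<and> distr P P S = P"

lemma sets_stdn [measurable_cong, simp]: "sets stdn = sets borel"
  by (simp add: stdn_def)

lemma space_stdn [simp]: "space stdn = UNIV"
  by (simp add: stdn_def)

lemma prob_space_stdn: "prob_space stdn"
  unfolding stdn_def by (rule prob_space_normal_density) simp

lemma product_prob_space_stdn: "product_prob_space (\<lambda>_::'i. stdn)"
  by (intro product_prob_spaceI prob_space_stdn)

lemma product_sigma_finite_stdn: "product_sigma_finite (\<lambda>_::'i. stdn)"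
  by (rule product_prob_space.axioms(1)[OF product_prob_space_stdn])

lemma prob_space_gauss: "prob_space (gauss I)"
  unfolding gauss_def by (intro prob_space_PiM prob_space_stdn)

lemma sets_gauss [measurable_cong]: "sets (gauss I) = sets (PiM I (\<lambda>_. borel))"
  unfolding gauss_def by (intro sets_PiM_cong) auto

lemma space_gauss: "space (gauss I) = PiE I (\<lambda>_. UNIV)"
  by (simp add: gauss_def space_PiM)

lemma preserves_id: "preserves P (\<lambda>x. x)"
  by (simp add: preserves_def)

lemma preserves_comp:
  assumes "preserves P S" "preserves P T"
  shows "preserves P (\<lambda>x. S (T x))"
proof -
  have [measurable]: "S \<in> measurable P P" "T \<in> measurable P P"
    using assms by (auto simp: preserves_def)
  have "distr P P (\<lambda>x. S (T x)) = distr (distr P P T) P S"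
    by (simp add: distr_distr comp_def)
  also have "\<dots> = P" using assms by (simp add: preserves_def)
  finally show ?thesis by (simp add: preserves_def)
qed

lemma preserves_measure:
  assumes "preserves P S" "A \<in> sets P"
  shows "measure P (S -` A \<inter> space P) = measure P A"
  using assms measure_distr[of S P P A] by (simp add: preserves_def)

text \<open>Two one-dimensional affine substitutions, exchanged by Fubini, carry out the planar rotation.\<close>

lemma lborel_rotation:
  fixes H :: "real \<Rightarrow> real \<Rightarrow> ennreal"
  assumes H [measurable]: "(\<lambda>(u, v). H u v) \<in> borel_measurable (borel \<Otimes>\<^sub>M borel)"
  shows "(\<integral>\<^sup>+t. \<integral>\<^sup>+s. H ((s + t) / sqrt 2) ((s - t) / sqrt 2) \<partial>lborel \<partial>lborel)
       = (\<integral>\<^sup>+v. \<integral>\<^sup>+u. H u v \<partial>lborel \<partial>lborel)"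
proof -
  \<comment> \<open>The substitution \<open>s = - t + sqrt 2 * u\<close> turns the first argument of
    \<open>H\<close> into \<open>u\<close> and the second into
    \<open>u - sqrt 2 * t\<close>.\<close>
  have 1: "(- t + sqrt 2 * u - t) / sqrt 2 = u + (- sqrt 2) * t" for t u :: real
  proof -
    have "(2 * t) / sqrt 2 = sqrt 2 * t"
      by (metis mult.commute real_div_sqrt times_divide_eq_right zero_le_numeral)
    moreover have "(- t + sqrt 2 * u - t) / sqrt 2 = u - (2 * t) / sqrt 2"
      by (simp add: field_simps)
    ultimately show ?thesis by simp
  qed
  have [measurable]: "(\<lambda>x. H (f x) (g x)) \<in> borel_measurable N"
    if "f \<in> borel_measurable N" "g \<in> borel_measurable N" for f g and N :: "'b measure"
    using measurable_compose[OF measurable_Pair[OF that] H] by simp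
  have "(\<integral>\<^sup>+t. \<integral>\<^sup>+s. H ((s + t) / sqrt 2) ((s - t) / sqrt 2) \<partial>lborel \<partial>lborel)
      = (\<integral>\<^sup>+t. ennreal \<bar>sqrt 2\<bar> * \<integral>\<^sup>+u. H ((- t + sqrt 2 * u + t) / sqrt 2) ((- t + sqrt 2 * u - t) / sqrt 2) \<partial>lborel \<partial>lborel)"
    by (intro nn_integral_cong nn_integral_real_affine) auto
  also have "\<dots> = (\<integral>\<^sup>+t. \<integral>\<^sup>+u. ennreal \<bar>sqrt 2\<bar> * H u (u + (- sqrt 2) * t) \<partial>lborel \<partial>lborel)"
    unfolding 1 by (intro nn_integral_cong) (simp add: nn_integral_cmult)
  also have "\<dots> = (\<integral>\<^sup>+u. \<integral>\<^sup>+t. ennreal \<bar>sqrt 2\<bar> * H u (u + (- sqrt 2) * t) \<partial>lborel \<partial>lborel)"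
    by (rule lborel_pair.Fubini') measurable
  also have "\<dots> = (\<integral>\<^sup>+u. \<integral>\<^sup>+v. H u v \<partial>lborel \<partial>lborel)"
  proof (rule nn_integral_cong)
    fix u :: real
    \<comment> \<open>The factor \<open>sqrt 2\<close> left by the first substitution is exactly the
      Jacobian of the second one, \<open>v = u - sqrt 2 * t\<close>.\<close>
    have "(\<integral>\<^sup>+v. H u v \<partial>lborel) = ennreal \<bar>- sqrt 2\<bar> * (\<integral>\<^sup>+t. H u (u + (- sqrt 2) * t) \<partial>lborel)"
      by (intro nn_integral_real_affine) auto
    then show "(\<integral>\<^sup>+t. ennreal \<bar>sqrt 2\<bar> * H u (u + (- sqrt 2) * t) \<partial>lborel) = (\<integral>\<^sup>+v. H u v \<partial>lborel)"
      by (simp add: nn_integral_cmult)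
  qed
  also have "\<dots> = (\<integral>\<^sup>+v. \<integral>\<^sup>+u. H u v \<partial>lborel \<partial>lborel)"
    by (rule lborel_pair.Fubini'[symmetric]) measurable
  finally show ?thesis .
qed

text \<open>The product density depends only on \<open>s\<^sup>2 + t\<^sup>2\<close>, which the
  rotation preserves, so the Lebesgue version carries over.\<close>

lemma stdn_rotation:
  fixes h :: "real \<Rightarrow> real \<Rightarrow> ennreal"
  assumes h [measurable]: "(\<lambda>(u, v). h u v) \<in> borel_measurable (borel \<Otimes>\<^sub>M borel)"
  shows "(\<integral>\<^sup>+t. \<integral>\<^sup>+s. h ((s + t) / sqrt 2) ((s - t) / sqrt 2) \<partial>stdn \<partial>stdn)
       = (\<integral>\<^sup>+v. \<integral>\<^sup>+u. h u v \<partial>stdn \<partial>stdn)"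
proof -
  define \<phi> where "\<phi> x = ennreal (std_normal_density x)" for x
  have [measurable]: "\<phi> \<in> borel_measurable borel" unfolding \<phi>_def by measurable
  have [measurable]: "(\<lambda>x. h (f x) (g x)) \<in> borel_measurable N"
    if "f \<in> borel_measurable N" "g \<in> borel_measurable N" for f g and N :: "'b measure"
    using measurable_compose[OF measurable_Pair[OF that] h] by simp
  have *: "(\<integral>\<^sup>+t. \<integral>\<^sup>+s. k s t \<partial>stdn \<partial>stdn) = (\<integral>\<^sup>+t. \<integral>\<^sup>+s. \<phi> s * \<phi> t * k s t \<partial>lborel \<partial>lborel)"
    if [measurable]: "(\<lambda>(s, t). k s t) \<in> borel_measurable (borel \<Otimes>\<^sub>M borel)" for k
  proof -
    have [measurable]: "(\<lambda>x. k (f x) (g x)) \<in> borel_measurable N"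
      if "f \<in> borel_measurable N" "g \<in> borel_measurable N" for f g and N :: "'c measure"
      using measurable_compose[OF measurable_Pair[OF that] \<open>(\<lambda>(s, t). k s t) \<in> _\<close>] by simp
    show ?thesis
      unfolding stdn_def \<phi>_def[symmetric]
      by (simp add: nn_integral_density nn_integral_cmult[symmetric] ac_simps)
  qed
  have **: "\<phi> ((s + t) / sqrt 2) * \<phi> ((s - t) / sqrt 2) = \<phi> s * \<phi> t" for s t
  proof -
    have "(s + t)\<^sup>2 / 2 + (s - t)\<^sup>2 / 2 = s\<^sup>2 + t\<^sup>2"
      by (simp add: power2_eq_square field_simps)
    then have e: "- ((s + t) / sqrt 2)\<^sup>2 / 2 + - ((s - t) / sqrt 2)\<^sup>2 / 2 = - s\<^sup>2 / 2 + - t\<^sup>2 / 2"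
      by (simp add: power_divide)
    have "exp (- ((s + t) / sqrt 2)\<^sup>2 / 2) * exp (- ((s - t) / sqrt 2)\<^sup>2 / 2) = exp (- s\<^sup>2 / 2) * exp (- t\<^sup>2 / 2)"
      unfolding exp_add[symmetric] e ..
    then show ?thesis
      unfolding \<phi>_def ennreal_mult[OF normal_density_nonneg normal_density_nonneg, symmetric]
      by (simp add: std_normal_density_def)
  qed
  have "(\<integral>\<^sup>+t. \<integral>\<^sup>+s. h ((s + t) / sqrt 2) ((s - t) / sqrt 2) \<partial>stdn \<partial>stdn)
      = (\<integral>\<^sup>+t. \<integral>\<^sup>+s. \<phi> ((s + t) / sqrt 2) * \<phi> ((s - t) / sqrt 2) * h ((s + t) / sqrt 2) ((s - t) / sqrt 2) \<partial>lborel \<partial>lborel)"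
    unfolding ** by (rule *) measurable
  also have "\<dots> = (\<integral>\<^sup>+v. \<integral>\<^sup>+u. \<phi> u * \<phi> v * h u v \<partial>lborel \<partial>lborel)"
    by (rule lborel_rotation) measurable
  also have "\<dots> = (\<integral>\<^sup>+v. \<integral>\<^sup>+u. h u v \<partial>stdn \<partial>stdn)"
    by (rule *[symmetric]) measurable
  finally show ?thesis .
qed

text \<open>Fubini isolates the coordinates \<open>a\<close> and \<open>b\<close>; with all others
  frozen, \<open>stdn_rotation\<close> applies. The block acting on the pair is the normalized
  Hadamard matrix of order 2.\<close>

lemma preserves_gauss_rotation:
  assumes I: "finite I" "a \<in> I" "b \<in> I" "a \<noteq> b"
  shows "preserves (gauss I) (\<lambda>z. z(a := (z a + z b) / sqrt 2, b := (z a - z b) / sqrt 2))"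
    (is "preserves _ ?R")
proof -
  interpret product_sigma_finite "\<lambda>_::'a. stdn" by (rule product_sigma_finite_stdn)
  define J where "J = I - {a, b}"
  have J: "I = insert a (insert b J)" "finite J" "a \<notin> insert b J" "b \<notin> J"
    using I by (auto simp: J_def)
  have R [measurable]: "?R \<in> measurable (gauss I) (gauss I)"
    unfolding gauss_def
  proof (rule measurable_PiM_single')
    fix i assume "i \<in> I"
    then show "(\<lambda>z. ?R z i) \<in> Pi\<^sub>M I (\<lambda>_. stdn) \<rightarrow>\<^sub>M stdn"
      using I by (cases "i = a"; cases "i = b") simp_all
  qed (use I in \<open>auto simp: space_PiM PiE_iff extensional_def\<close>)
  have int: "(\<integral>\<^sup>+z. f (?R z) \<partial>gauss I) = (\<integral>\<^sup>+z. f z \<partial>gauss I)"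
    if f: "f \<in> borel_measurable (gauss I)" for f
  proof -
    note [measurable] = f[unfolded gauss_def J(1)]
    have fR: "(\<lambda>z. f (?R z)) \<in> borel_measurable (Pi\<^sub>M (insert a (insert b J)) (\<lambda>_. stdn))"
      using measurable_compose[OF R f] unfolding gauss_def J(1) .
    have split: "(\<integral>\<^sup>+z. k z \<partial>gauss I) = (\<integral>\<^sup>+x. \<integral>\<^sup>+t. \<integral>\<^sup>+s. k (x(b := t, a := s)) \<partial>stdn \<partial>stdn \<partial>PiM J (\<lambda>_. stdn))"
      if [measurable]: "k \<in> borel_measurable (Pi\<^sub>M (insert a (insert b J)) (\<lambda>_. stdn))" for k
      unfolding gauss_def J(1)
      apply (subst product_nn_integral_insert)
         apply (use J in simp_all)
      apply (subst product_nn_integral_insert)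
         apply (use J in simp_all)
      apply measurable
      done
    have "(\<integral>\<^sup>+z. f (?R z) \<partial>gauss I)
        = (\<integral>\<^sup>+x. \<integral>\<^sup>+t. \<integral>\<^sup>+s. f (?R (x(b := t, a := s))) \<partial>stdn \<partial>stdn \<partial>PiM J (\<lambda>_. stdn))"
      by (rule split[OF fR])
    also have "\<dots> = (\<integral>\<^sup>+x. \<integral>\<^sup>+t. \<integral>\<^sup>+s. f (x(b := (s - t) / sqrt 2, a := (s + t) / sqrt 2)) \<partial>stdn \<partial>stdn \<partial>PiM J (\<lambda>_. stdn))"
      using I by (simp add: fun_upd_twist fun_upd_def cong: if_cong)
         (intro nn_integral_cong arg_cong[where f=f] ext, auto)
    also have "\<dots> = (\<integral>\<^sup>+x. \<integral>\<^sup>+t. \<integral>\<^sup>+s. f (x(b := t, a := s)) \<partial>stdn \<partial>stdn \<partial>PiM J (\<lambda>_. stdn))"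
    proof (rule nn_integral_cong)
      fix x assume x [measurable]: "x \<in> space (PiM J (\<lambda>_. stdn))"
      show "(\<integral>\<^sup>+t. \<integral>\<^sup>+s. f (x(b := (s - t) / sqrt 2, a := (s + t) / sqrt 2)) \<partial>stdn \<partial>stdn)
          = (\<integral>\<^sup>+t. \<integral>\<^sup>+s. f (x(b := t, a := s)) \<partial>stdn \<partial>stdn)"
        by (rule stdn_rotation[where h = "\<lambda>s t. f (x(b := t, a := s))"]) measurable
    qed
    also have "\<dots> = (\<integral>\<^sup>+z. f z \<partial>gauss I)"
      by (rule split[symmetric]) measurable
    finally show ?thesis .
  qed
  have "distr (gauss I) (gauss I) ?R = gauss I"
  proof (rule measure_eqI)
    fix A assume "A \<in> sets (distr (gauss I) (gauss I) ?R)"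
    then have [measurable]: "A \<in> sets (gauss I)" by simp
    have "emeasure (distr (gauss I) (gauss I) ?R) A = (\<integral>\<^sup>+z. indicator A z \<partial>distr (gauss I) (gauss I) ?R)"
      by simp
    also have "\<dots> = (\<integral>\<^sup>+z. indicator A (?R z) \<partial>gauss I)"
      by (rule nn_integral_distr) measurable
    also have "\<dots> = (\<integral>\<^sup>+z. indicator A z \<partial>gauss I)" by (rule int) measurable
    also have "\<dots> = emeasure (gauss I) A" by simp
    finally show "emeasure (distr (gauss I) (gauss I) ?R) A = emeasure (gauss I) A" .
  qed simp
  with R show ?thesis by (simp add: preserves_def)
qed

text \<open>The density is even, so each factor is invariant, and a product measure is determined by
  its values on boxes. This serves both random signs and the passage from \<open>G\<close> to
  \<open>- G\<close>.\<close>

lemma preserves_gauss_sign: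
  assumes I: "finite I" and s: "\<And>i. i \<in> I \<Longrightarrow> \<bar>s i\<bar> = (1::real)"
  shows "preserves (gauss I) (\<lambda>z. \<lambda>i\<in>I. s i * z i)" (is "preserves _ ?R")
proof -
  interpret product_sigma_finite "\<lambda>_::'a. stdn" by (rule product_sigma_finite_stdn)
  have R [measurable]: "?R \<in> measurable (gauss I) (gauss I)"
    unfolding gauss_def by (rule measurable_restrict) simp
  have sym: "emeasure stdn {x. c * x \<in> B} = emeasure stdn B"
    if [measurable]: "B \<in> sets borel" and c: "\<bar>c\<bar> = 1" for c :: real and B
  proof -
    have [measurable]: "{x. c * x \<in> B} \<in> sets borel" by measurable
    have c2: "c\<^sup>2 = 1" using c by (metis power2_abs one_power2)
    have cc: "c * (c * x) = x" for x using c2 by (simp add: power2_eq_square flip: mult.assoc)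
    have "emeasure stdn {x. c * x \<in> B} = (\<integral>\<^sup>+x. ennreal (std_normal_density x) * indicator {x. c * x \<in> B} x \<partial>lborel)"
      by (simp add: stdn_def emeasure_density)
    also have "\<dots> = ennreal \<bar>c\<bar> * (\<integral>\<^sup>+x. ennreal (std_normal_density (0 + c * x)) * indicator {x. c * x \<in> B} (0 + c * x) \<partial>lborel)"
      by (rule nn_integral_real_affine) (use c in auto)
    also have "\<dots> = (\<integral>\<^sup>+x. ennreal (std_normal_density x) * indicator B x \<partial>lborel)"
      using c by (simp add: std_normal_density_def power_mult_distrib c2 cc indicator_def)
    also have "\<dots> = emeasure stdn B"
      by (simp add: stdn_def emeasure_density)
    finally show ?thesis .
  qed
  have "distr (gauss I) (gauss I) ?R = PiM I (\<lambda>_. stdn)"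
  proof (rule PiM_eqI)
    fix A assume A: "\<And>i. i \<in> I \<Longrightarrow> A i \<in> sets stdn"
    have "emeasure (distr (gauss I) (gauss I) ?R) (Pi\<^sub>E I A) = emeasure (gauss I) (?R -` Pi\<^sub>E I A \<inter> space (gauss I))"
      using A by (intro emeasure_distr) (auto simp: gauss_def I intro!: sets_PiM_I_finite)
    also have "?R -` Pi\<^sub>E I A \<inter> space (gauss I) = Pi\<^sub>E I (\<lambda>i. {x. s i * x \<in> A i})"
      by (auto simp: space_gauss PiE_iff)
    also have "emeasure (gauss I) \<dots> = (\<Prod>i\<in>I. emeasure stdn {x. s i * x \<in> A i})"
      unfolding gauss_def
    proof (rule emeasure_PiM[OF I])
      fix i assume "i \<in> I"
      then have [measurable]: "A i \<in> sets borel" using A by simp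
      show "{x. s i * x \<in> A i} \<in> sets stdn" by simp
    qed
    also have "\<dots> = (\<Prod>i\<in>I. emeasure stdn (A i))"
      using A s by (intro prod.cong sym) auto
    finally show "emeasure (distr (gauss I) (gauss I) ?R) (Pi\<^sub>E I A) = (\<Prod>i\<in>I. emeasure stdn (A i))" .
  qed (auto simp: I gauss_def)
  with R show ?thesis by (simp add: preserves_def gauss_def)
qed


subsection \<open>Hadamard rotations\<close>

text \<open>One layer of the fast Walsh-Hadamard transform: \<open>\<sigma>\<close> matches
  coordinates of \<open>A\<close> in pairs, and \<open>s\<close> tells which partner receives the
  sum (\<open>1\<close>) and which the difference (\<open>- 1\<close>).\<close>

definition butterfly :: "('i \<Rightarrow> 'i) \<Rightarrow> ('i \<Rightarrow> real) \<Rightarrow> 'i set \<Rightarrow> ('i \<Rightarrow> real) \<Rightarrow> 'i \<Rightarrow> real" where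
  "butterfly \<sigma> s A z i = (if i \<in> A then (z (\<sigma> i) + s i * z i) / sqrt 2 else z i)"

definition pairing :: "('i \<Rightarrow> 'i) \<Rightarrow> ('i \<Rightarrow> real) \<Rightarrow> 'i set \<Rightarrow> bool" where
  "pairing \<sigma> s A \<longleftrightarrow> (\<forall>i\<in>A. \<sigma> i \<in> A \<and> \<sigma> (\<sigma> i) = i \<and> s (\<sigma> i) = - s i \<and> \<bar>s i\<bar> = 1)"

text \<open>The pairs are disjoint, so they can be split off one at a time, each contributing one
  planar rotation.\<close>

lemma preserves_butterfly:
  assumes "finite I" "A \<subseteq> I" "pairing \<sigma> s A"
  shows "preserves (gauss I) (butterfly \<sigma> s A)"
  using finite_subset[OF assms(2,1)] assms(2,3)
proof (induction A rule: finite_psubset_induct)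
  case (psubset A)
  show ?case
  proof (cases "A = {}")
    case True
    then have "butterfly \<sigma> s A = (\<lambda>z. z)" by (auto simp: butterfly_def fun_eq_iff)
    then show ?thesis by (simp add: preserves_id)
  next
    case False
    then obtain c where c: "c \<in> A" by auto
    \<comment> \<open>\<open>a\<close> is the member of the pair with sign \<open>1\<close>, so that
      the orientation agrees with that of \<open>preserves_gauss_rotation\<close>.\<close>
    define a where "a = (if s c = 1 then c else \<sigma> c)"
    define b where "b = \<sigma> a"
    have p: "\<sigma> i \<in> A" "\<sigma> (\<sigma> i) = i" "s (\<sigma> i) = - s i" "\<bar>s i\<bar> = 1" if "i \<in> A" for i
      using psubset.prems(2) that unfolding pairing_def by blast+
    have "s c = 1 \<or> s c = -1" using p(4)[OF c] by linarith
    then have a: "a \<in> A" "s a = 1"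
      using p(1,3)[OF c] c by (auto simp: a_def)
    then have b: "b \<in> A" "s b = -1" "\<sigma> b = a"
      using p[OF a(1)] by (auto simp: b_def)
    then have ab: "a \<noteq> b" using a by auto
    note b = b ab
    have "\<sigma> i \<in> A - {a, b}" if "i \<in> A - {a, b}" for i
    proof -
      have "\<sigma> i \<noteq> a" "\<sigma> i \<noteq> b" using that p(2)[of i] b b_def by auto
      then show ?thesis using that p(1)[of i] by simp
    qed
    then have "pairing \<sigma> s (A - {a, b})"
      using psubset.prems(2) unfolding pairing_def by blast
    then have "preserves (gauss I) (butterfly \<sigma> s (A - {a, b}))"
      using psubset.prems a by (intro psubset.IH) auto
    then have "preserves (gauss I)
        (\<lambda>z. (\<lambda>z. z(a := (z a + z b) / sqrt 2, b := (z a - z b) / sqrt 2)) (butterfly \<sigma> s (A - {a, b}) z))"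
      using a b psubset.prems assms(1)
      by (intro preserves_comp[OF preserves_gauss_rotation]) auto
    also have "(\<lambda>z. (\<lambda>z. z(a := (z a + z b) / sqrt 2, b := (z a - z b) / sqrt 2)) (butterfly \<sigma> s (A - {a, b}) z))
        = butterfly \<sigma> s A"
      using a b by (auto simp: butterfly_def fun_eq_iff b_def[symmetric] add.commute)
    finally show ?thesis .
  qed
qed

text \<open>Orthogonality, in the bilinear form needed to pair a matrix with a rank-one
  matrix.\<close>

lemma sum_butterfly_mult:
  assumes "finite I" "A \<subseteq> I" "pairing \<sigma> s A"
  shows "(\<Sum>i\<in>I. butterfly \<sigma> s A z i * butterfly \<sigma> s A w i) = (\<Sum>i\<in>I. z i * w i)"
proof -
  have p: "\<sigma> i \<in> A" "\<sigma> (\<sigma> i) = i" "s (\<sigma> i) = - s i" "\<bar>s i\<bar> = 1" if "i \<in> A" for i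
    using assms(3) that unfolding pairing_def by blast+
  have reindex: "(\<Sum>i\<in>A. h (\<sigma> i)) = (\<Sum>i\<in>A. h i)" for h :: "'a \<Rightarrow> real"
    by (rule sum.reindex_bij_witness[of _ \<sigma> \<sigma>]) (auto simp: p)
  \<comment> \<open>The cross terms of the product: \<open>h\<close> is odd under the involution
    \<open>\<sigma>\<close>, so it sums to 0.\<close>
  define h where "h i = s i * (z i * w (\<sigma> i) + z (\<sigma> i) * w i)" for i
  have "(\<Sum>i\<in>A. h (\<sigma> i)) = (\<Sum>i\<in>A. - h i)"
    by (intro sum.cong refl) (simp add: h_def p algebra_simps)
  then have h0: "(\<Sum>i\<in>A. h i) = 0" by (simp add: reindex sum_negf)
  have "(\<Sum>i\<in>A. butterfly \<sigma> s A z i * butterfly \<sigma> s A w i)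
      = (\<Sum>i\<in>A. (z (\<sigma> i) * w (\<sigma> i) + z i * w i + h i) / 2)"
  proof (intro sum.cong refl)
    fix i assume i: "i \<in> A"
    have "(s i)\<^sup>2 = 1" using p(4)[OF i] by (metis power2_abs one_power2)
    then have s2: "s i * (s i * x) = x" for x by (simp add: power2_eq_square flip: mult.assoc)
    show "butterfly \<sigma> s A z i * butterfly \<sigma> s A w i = (z (\<sigma> i) * w (\<sigma> i) + z i * w i + h i) / 2"
      using i by (simp add: butterfly_def h_def algebra_simps s2)
  qed
  also have "\<dots> = (\<Sum>i\<in>A. z i * w i)"
    by (simp add: sum_divide_distrib[symmetric] sum.distrib h0 reindex[of "\<lambda>i. z i * w i"])
  finally have "(\<Sum>i\<in>A. butterfly \<sigma> s A z i * butterfly \<sigma> s A w i) = (\<Sum>i\<in>A. z i * w i)" .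
  moreover have "(\<Sum>i\<in>I - A. butterfly \<sigma> s A z i * butterfly \<sigma> s A w i) = (\<Sum>i\<in>I - A. z i * w i)"
    by (intro sum.cong) (auto simp: butterfly_def)
  ultimately show ?thesis
    using sum.subset_diff[OF assms(2,1)] by metis
qed

abbreviation idx :: "nat \<Rightarrow> (nat \<times> nat) set" where
  "idx n \<equiv> {1..n} \<times> {1..n}"

text \<open>The quadratic form is the Euclidean inner product, over index pairs, of the matrix with
  the rank-one matrix built from \<open>x\<close>. Orthogonal maps acting on both leave it
  unchanged.\<close>

lemma quad_form_curry:
  "quad_form n (curry z) x = (\<Sum>p\<in>idx n. z p * (x (fst p) * x (snd p)))"
  unfolding quad_form_def sum_distrib_right
  by (simp add: sum.cartesian_product case_prod_beta ac_simps)

text \<open>On the level of laws, \<open>G\<close> may be replaced by \<open>L G L\<^sup>T\<close>.\<close>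

definition gauss_rot :: "nat \<Rightarrow> ((nat \<Rightarrow> real) \<Rightarrow> nat \<Rightarrow> real) \<Rightarrow> bool" where
  "gauss_rot n L \<longleftrightarrow> (\<exists>S. preserves (gauss (idx n)) S \<and>
     (\<forall>z x. quad_form n (curry (S z)) (L x) = quad_form n (curry z) x))"

lemma gauss_rot_id: "gauss_rot n (\<lambda>x. x)"
  unfolding gauss_rot_def by (intro exI[of _ "\<lambda>z. z"]) (simp add: preserves_id)

lemma gauss_rot_comp:
  assumes "gauss_rot n L" "gauss_rot n K"
  shows "gauss_rot n (\<lambda>x. L (K x))"
proof -
  obtain S where S: "preserves (gauss (idx n)) S"
    "\<And>z x. quad_form n (curry (S z)) (L x) = quad_form n (curry z) x"
    using assms(1) unfolding gauss_rot_def by (elim exE conjE) simp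
  obtain T where T: "preserves (gauss (idx n)) T"
    "\<And>z x. quad_form n (curry (T z)) (K x) = quad_form n (curry z) x"
    using assms(2) unfolding gauss_rot_def by (elim exE conjE) simp
  show ?thesis unfolding gauss_rot_def
    by (intro exI[of _ "\<lambda>z. S (T z)"] conjI preserves_comp[OF S(1) T(1)]) (simp add: S T)
qed

lemma gauss_rot_sign:
  assumes "\<And>i. \<bar>e i\<bar> = (1::real)"
  shows "gauss_rot n (\<lambda>x i. e i * x i)"
proof -
  have "(e i)\<^sup>2 = 1" for i using assms by (metis power2_abs one_power2)
  then have e2: "e i * (e i * x) = x" for x i by (simp add: power2_eq_square flip: mult.assoc)
  define S where "S z = (\<lambda>p\<in>idx n. (e (fst p) * e (snd p)) * z p)" for z
  have "preserves (gauss (idx n)) S"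
    unfolding S_def by (rule preserves_gauss_sign) (auto simp: abs_mult assms)
  moreover have "quad_form n (curry (S z)) (\<lambda>i. e i * x i) = quad_form n (curry z) x" for z x
    unfolding quad_form_curry
  proof (intro sum.cong refl)
    fix p assume "p \<in> idx n"
    from this have "S z p * (e (fst p) * x (fst p) * (e (snd p) * x (snd p)))
      = (e (fst p) * (e (fst p) * (e (snd p) * (e (snd p) * (z p * (x (fst p) * x (snd p)))))))"
      unfolding S_def restrict_def by (simp only: if_True mult_ac)
    then show "S z p * (e (fst p) * x (fst p) * (e (snd p) * x (snd p))) = z p * (x (fst p) * x (snd p))"
      by (simp add: e2)
  qed
  ultimately show ?thesis unfolding gauss_rot_def by (intro exI[of _ S]) simp
qed

text \<open>Conjugating the matrix means one butterfly on its rows and one on its columns, and each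
  is itself a butterfly on \<open>idx n\<close>. Together they send the rank-one matrix of
  \<open>x\<close> to that of the transformed \<open>x\<close>, so orthogonality preserves the
  pairing.\<close>

lemma gauss_rot_butterfly:
  assumes "A \<subseteq> {1..n}" "pairing \<sigma> s A"
  shows "gauss_rot n (butterfly \<sigma> s A)"
proof -
  define R where "R = butterfly (\<lambda>p. (\<sigma> (fst p), snd p)) (\<lambda>p. s (fst p)) (A \<times> {1..n})"
  define C where "C = butterfly (\<lambda>p. (fst p, \<sigma> (snd p))) (\<lambda>p. s (snd p)) ({1..n} \<times> A)"
  have R: "A \<times> {1..n} \<subseteq> idx n" "pairing (\<lambda>p. (\<sigma> (fst p), snd p)) (\<lambda>p. s (fst p)) (A \<times> {1..n})"
   and C: "{1..n} \<times> A \<subseteq> idx n" "pairing (\<lambda>p. (fst p, \<sigma> (snd p))) (\<lambda>p. s (snd p)) ({1..n} \<times> A)"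
    using assms by (auto simp: pairing_def)
  have "preserves (gauss (idx n)) (\<lambda>z. R (C z))"
    unfolding R_def C_def
    by (rule preserves_comp[OF preserves_butterfly[OF _ R] preserves_butterfly[OF _ C]]) auto
  moreover have "quad_form n (curry (R (C z))) (butterfly \<sigma> s A x) = quad_form n (curry z) x" for z x
  proof -
    define w where "w p = x (fst p) * x (snd p)" for p
    have w: "R (C w) p = butterfly \<sigma> s A x (fst p) * butterfly \<sigma> s A x (snd p)" if "p \<in> idx n" for p
      using that assms by (cases p) (auto simp: R_def C_def butterfly_def w_def pairing_def field_simps subset_iff)
    have "quad_form n (curry (R (C z))) (butterfly \<sigma> s A x) = (\<Sum>p\<in>idx n. R (C z) p * R (C w) p)"
      unfolding quad_form_curry by (intro sum.cong refl) (metis w)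
    also have "\<dots> = (\<Sum>p\<in>idx n. C z p * C w p)"
      unfolding R_def by (rule sum_butterfly_mult) (use R in auto)
    also have "\<dots> = (\<Sum>p\<in>idx n. z p * w p)"
      unfolding C_def by (rule sum_butterfly_mult) (use C in auto)
    also have "\<dots> = quad_form n (curry z) x" by (simp add: quad_form_curry w_def)
    finally show ?thesis .
  qed
  ultimately show ?thesis unfolding gauss_rot_def by (intro exI[of _ "\<lambda>z. R (C z)"]) auto
qed

text \<open>Two halves of \<open>A\<close> are joined by one butterfly, as in the fast Walsh--Hadamard transform.\<close>

lemma hadamard_rot:
  assumes "A \<subseteq> {1..n}" "card A = 2 ^ k"
  shows "\<exists>L \<rho>. gauss_rot n L \<and> (\<forall>x. \<forall>i\<in>A. L x i = (\<Sum>j\<in>A. \<rho> i j * x j) / sqrt (2 ^ k))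
    \<and> (\<forall>x. \<forall>i. i \<notin> A \<longrightarrow> L x i = x i) \<and> (\<forall>i\<in>A. \<forall>j\<in>A. \<bar>\<rho> i j\<bar> = (1::real))"
  using assms
proof (induction k arbitrary: A)
  case 0
  then obtain a where "A = {a}" by (metis card_1_singletonE power_0)
  then show ?case
    by (intro exI[of _ "\<lambda>x. x"] exI[of _ "\<lambda>_ _. 1"]) (simp add: gauss_rot_id)
next
  case (Suc k)
  have fA: "finite A" using finite_subset[OF Suc.prems(1)] by simp
  obtain A1 where A1: "A1 \<subseteq> A" "card A1 = 2 ^ k"
    using obtain_subset_with_card_n[of "2 ^ k" A] Suc.prems(2) by (metis power_increasing_iff le_SucI order_refl one_less_numeral_iff semiring_norm(76))
  define A2 where "A2 = A - A1"
  have A2: "A2 \<subseteq> A" "card A2 = 2 ^ k" "A1 \<inter> A2 = {}" "A = A1 \<union> A2" "finite A1" "finite A2"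
    using A1 Suc.prems fA finite_subset[OF A1(1) fA]
    by (auto simp: A2_def card_Diff_subset)
  obtain f where f: "bij_betw f A1 A2"
    using finite_same_card_bij[OF A2(5,6)] A1(2) A2(2) by metis
  define h where "h = inv_into A1 f"
  have fh: "f i \<in> A2" "h (f i) = i" if "i \<in> A1" for i
    using bij_betwE[OF f] bij_betw_inv_into_left[OF f] that by (simp_all add: h_def)
  have hf: "h i \<in> A1" "f (h i) = i" if "i \<in> A2" for i
    using bij_betwE[OF bij_betw_inv_into[OF f]] bij_betw_inv_into_right[OF f] that
    by (simp_all add: h_def)
  define \<sigma> where "\<sigma> i = (if i \<in> A1 then f i else h i)" for i
  define s where "s i = (if i \<in> A1 then 1 else - 1 :: real)" for i
  have pair: "pairing \<sigma> s A"
    unfolding pairing_def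
  proof
    fix i assume "i \<in> A"
    then consider "i \<in> A1" "i \<notin> A2" | "i \<in> A2" "i \<notin> A1" using A2(3,4) by blast
    then show "\<sigma> i \<in> A \<and> \<sigma> (\<sigma> i) = i \<and> s (\<sigma> i) = - s i \<and> \<bar>s i\<bar> = 1"
    proof cases
      case 1
      moreover have "f i \<notin> A1" using fh(1)[OF 1(1)] A2(3) by blast
      moreover have "f i \<in> A" using fh(1)[OF 1(1)] A2(1) by blast
      ultimately show ?thesis using fh[OF 1(1)] by (simp add: \<sigma>_def s_def)
    next
      case 2
      moreover have "h i \<in> A" using hf(1)[OF 2(1)] A1(1) by blast
      ultimately show ?thesis using hf[OF 2(1)] by (simp add: \<sigma>_def s_def)
    qed
  qed
  obtain L1 \<rho>1 where 1: "gauss_rot n L1" "\<And>x i. i \<in> A1 \<Longrightarrow> L1 x i = (\<Sum>j\<in>A1. \<rho>1 i j * x j) / sqrt (2 ^ k)"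
     "\<And>x i. i \<notin> A1 \<Longrightarrow> L1 x i = x i" "\<And>i j. i \<in> A1 \<Longrightarrow> j \<in> A1 \<Longrightarrow> \<bar>\<rho>1 i j\<bar> = (1::real)"
    using Suc.IH[OF order.trans[OF A1(1) Suc.prems(1)] A1(2)] by blast
  obtain L2 \<rho>2 where 2: "gauss_rot n L2" "\<And>x i. i \<in> A2 \<Longrightarrow> L2 x i = (\<Sum>j\<in>A2. \<rho>2 i j * x j) / sqrt (2 ^ k)"
     "\<And>x i. i \<notin> A2 \<Longrightarrow> L2 x i = x i" "\<And>i j. i \<in> A2 \<Longrightarrow> j \<in> A2 \<Longrightarrow> \<bar>\<rho>2 i j\<bar> = (1::real)"
    using Suc.IH[OF order.trans[OF A2(1) Suc.prems(1)] A2(2)] by blast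
  \<comment> \<open>Sylvester's recursion: the block rows are \<open>\<rho>1, \<rho>2\<close> and
    \<open>\<rho>1, - \<rho>2\<close>, with \<open>f\<close> and \<open>h\<close> identifying the
    two halves.\<close>
  define \<rho> where "\<rho> i j = (if i \<in> A1 then if j \<in> A1 then \<rho>1 i j else \<rho>2 (f i) j
      else if j \<in> A1 then \<rho>1 (h i) j else - \<rho>2 i j)" for i j
  define L where "L x = butterfly \<sigma> s A (L1 (L2 x))" for x
  have y1: "L1 (L2 x) i = (\<Sum>j\<in>A1. \<rho>1 i j * x j) / sqrt (2 ^ k)" if "i \<in> A1" for x i
    unfolding 1(2)[OF that] using A2(3)
    by (intro arg_cong2[where f="(/)"] sum.cong refl arg_cong2[where f="(*)"] 2(3)) auto
  have y2: "L1 (L2 x) i = (\<Sum>j\<in>A2. \<rho>2 i j * x j) / sqrt (2 ^ k)" if "i \<in> A2" for x i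
  proof -
    have "i \<notin> A1" using that A2(3) by blast
    then show ?thesis by (simp add: 1(3) 2(2)[OF that])
  qed
  have "gauss_rot n L"
    unfolding L_def
    by (rule gauss_rot_comp[OF gauss_rot_butterfly[OF Suc.prems(1) pair] gauss_rot_comp[OF 1(1) 2(1)]])
  moreover have "L x i = (\<Sum>j\<in>A. \<rho> i j * x j) / sqrt (2 ^ Suc k)" if i: "i \<in> A" for x i
  proof -
    have sum: "(\<Sum>j\<in>A. \<rho> i j * x j) = (\<Sum>j\<in>A1. \<rho> i j * x j) + (\<Sum>j\<in>A2. \<rho> i j * x j)"
      unfolding A2(4) by (rule sum.union_disjoint) (use A2 in auto)
    have sq: "sqrt (2 * 2 ^ k) = sqrt (2 ^ k) * sqrt 2" by (simp add: real_sqrt_mult)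
    show ?thesis
    proof (cases "i \<in> A1")
      case True
      have "(\<Sum>j\<in>A1. \<rho> i j * x j) = (\<Sum>j\<in>A1. \<rho>1 i j * x j)"
        "(\<Sum>j\<in>A2. \<rho> i j * x j) = (\<Sum>j\<in>A2. \<rho>2 (f i) j * x j)"
        using True A2(3) by (auto intro!: sum.cong simp: \<rho>_def)
      then show ?thesis using True i fh
        by (simp add: L_def butterfly_def \<sigma>_def s_def y1 y2 sum sq add_divide_distrib)
    next
      case False
      then have i2: "i \<in> A2" using i A2 by auto
      have "(\<Sum>j\<in>A1. \<rho> i j * x j) = (\<Sum>j\<in>A1. \<rho>1 (h i) j * x j)"
        "(\<Sum>j\<in>A2. \<rho> i j * x j) = (\<Sum>j\<in>A2. - (\<rho>2 i j * x j))"
        using False A2(3) by (auto intro!: sum.cong simp: \<rho>_def)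
      then show ?thesis using False i i2 hf
        by (simp add: L_def butterfly_def \<sigma>_def s_def y1 y2 sum sq sum_negf add_divide_distrib diff_divide_distrib)
    qed
  qed
  moreover have "L x i = x i" if "i \<notin> A" for x i
    using that A2(4) 1(3)[of i] 2(3)[of i] by (simp add: L_def butterfly_def)
  moreover have "\<bar>\<rho> i j\<bar> = 1" if "i \<in> A" "j \<in> A" for i j
    using that A2(4) fh hf 1(4) 2(4) by (auto simp: \<rho>_def)
  ultimately show ?case by (intro exI[of _ L] exI[of _ \<rho>] conjI allI ballI impI)
qed

subsection \<open>Moments of Rademacher sums\<close>

text \<open>A sign pattern is encoded by the set of flipped coordinates, so a Rademacher expectation
  is a sum over \<open>Pow A\<close> divided by \<open>2 ^ card A\<close>.\<close>

definition flip_sign :: "'i set \<Rightarrow> 'i \<Rightarrow> real" where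
  "flip_sign T j = (if j \<in> T then - 1 else 1)"

lemma abs_flip_sign [simp]: "\<bar>flip_sign T j\<bar> = 1"
  by (simp add: flip_sign_def)

text \<open>Conditioning on the sign at \<open>x\<close>; this is the induction step of both moment
  computations.\<close>

lemma sum_Pow_insert_flip_sign:
  fixes \<phi> :: "real \<Rightarrow> real"
  assumes "finite A" "x \<notin> A"
  shows "(\<Sum>T\<in>Pow (insert x A). \<phi> (\<Sum>j\<in>insert x A. flip_sign T j * a j))
       = (\<Sum>T\<in>Pow A. \<phi> ((\<Sum>j\<in>A. flip_sign T j * a j) + a x) + \<phi> ((\<Sum>j\<in>A. flip_sign T j * a j) - a x))"
proof -
  have 1: "(\<Sum>j\<in>insert x A. flip_sign T j * a j) = (\<Sum>j\<in>A. flip_sign T j * a j) + a x"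
    and 2: "(\<Sum>j\<in>insert x A. flip_sign (insert x T) j * a j) = (\<Sum>j\<in>A. flip_sign T j * a j) - a x"
    if "T \<in> Pow A" for T
  proof -
    have "(\<Sum>j\<in>A. flip_sign (insert x T) j * a j) = (\<Sum>j\<in>A. flip_sign T j * a j)"
      using assms by (intro sum.cong) (auto simp: flip_sign_def)
    then show "(\<Sum>j\<in>insert x A. flip_sign T j * a j) = (\<Sum>j\<in>A. flip_sign T j * a j) + a x"
      "(\<Sum>j\<in>insert x A. flip_sign (insert x T) j * a j) = (\<Sum>j\<in>A. flip_sign T j * a j) - a x"
      using assms that by (auto simp: flip_sign_def[of _ x])
  qed
  have "inj_on (insert x) (Pow A)" using assms(2) by (auto simp: inj_on_def)
  moreover have "Pow A \<inter> insert x ` Pow A = {}" using assms(2) by auto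
  ultimately have "(\<Sum>T\<in>Pow (insert x A). \<phi> (\<Sum>j\<in>insert x A. flip_sign T j * a j))
      = (\<Sum>T\<in>Pow A. \<phi> (\<Sum>j\<in>insert x A. flip_sign T j * a j))
      + (\<Sum>T\<in>Pow A. \<phi> (\<Sum>j\<in>insert x A. flip_sign (insert x T) j * a j))"
    unfolding Pow_insert using assms(1) by (simp add: sum.union_disjoint sum.reindex)
  then show ?thesis by (simp add: 1 2 sum.distrib)
qed

lemma sum_flip_sign_square:
  assumes "finite A"
  shows "(\<Sum>T\<in>Pow A. (\<Sum>j\<in>A. flip_sign T j * a j)\<^sup>2) = 2 ^ card A * (\<Sum>j\<in>A. (a j)\<^sup>2)"
  using assms
proof induction
  case (insert x A)
  have "(\<Sum>T\<in>Pow (insert x A). (\<Sum>j\<in>insert x A. flip_sign T j * a j)\<^sup>2)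
      = (\<Sum>T\<in>Pow A. 2 * (\<Sum>j\<in>A. flip_sign T j * a j)\<^sup>2 + 2 * (a x)\<^sup>2)"
    unfolding sum_Pow_insert_flip_sign[OF insert.hyps, of "\<lambda>u. u\<^sup>2"]
    by (intro sum.cong) (auto simp: power2_eq_square algebra_simps)
  also have "\<dots> = 2 ^ card (insert x A) * (\<Sum>j\<in>insert x A. (a j)\<^sup>2)"
    using insert by (simp add: sum.distrib sum_distrib_left[symmetric] card_Pow algebra_simps)
  finally show ?case .
qed simp

text \<open>Khintchine's inequality for the fourth moment; the constant 3 is the fourth moment of a
  standard Gaussian.\<close>

lemma sum_flip_sign_power4:
  assumes "finite A"
  shows "(\<Sum>T\<in>Pow A. (\<Sum>j\<in>A. flip_sign T j * a j) ^ 4) \<le> 3 * 2 ^ card A * (\<Sum>j\<in>A. (a j)\<^sup>2)\<^sup>2"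
  using assms
proof induction
  case (insert x A)
  define Q where "Q = (\<Sum>j\<in>A. (a j)\<^sup>2)"
  have "(\<Sum>T\<in>Pow (insert x A). (\<Sum>j\<in>insert x A. flip_sign T j * a j) ^ 4)
      = (\<Sum>T\<in>Pow A. 2 * (\<Sum>j\<in>A. flip_sign T j * a j) ^ 4
          + 12 * (a x)\<^sup>2 * (\<Sum>j\<in>A. flip_sign T j * a j)\<^sup>2 + 2 * (a x) ^ 4)"
    unfolding sum_Pow_insert_flip_sign[OF insert.hyps, of "\<lambda>u. u ^ 4"]
    by (intro sum.cong) (auto simp: power2_eq_square power4_eq_xxxx algebra_simps)
  also have "\<dots> = 2 * (\<Sum>T\<in>Pow A. (\<Sum>j\<in>A. flip_sign T j * a j) ^ 4)
          + 12 * (a x)\<^sup>2 * (2 ^ card A * Q) + 2 ^ card A * (2 * (a x) ^ 4)"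
    using insert.hyps sum_flip_sign_square[OF insert.hyps(1), of a]
    by (simp add: sum.distrib sum_distrib_left[symmetric] card_Pow Q_def)
  \<comment> \<open>Raising the last coefficient from 2 to 6 is what completes the square.\<close>
  also have "\<dots> \<le> 2 * (3 * 2 ^ card A * Q\<^sup>2) + 12 * (a x)\<^sup>2 * (2 ^ card A * Q) + 2 ^ card A * (6 * (a x) ^ 4)"
    using insert.IH by (intro add_mono mult_left_mono) (auto simp: Q_def)
  also have "\<dots> = 3 * 2 ^ card (insert x A) * ((a x)\<^sup>2 + Q)\<^sup>2"
    using insert.hyps by (simp add: power2_eq_square power4_eq_xxxx algebra_simps)
  finally show ?case using insert.hyps by (simp add: Q_def)
qed simp


subsection \<open>Deterministic estimates\<close>

text \<open>In terms of \<open>y = n powr (1/p) * x\<close> the normalisation by a power of \<open>n\<close> no longer depends on \<open>p\<close>,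
  and only the ball does.\<close>

definition normalized_ball :: "nat \<Rightarrow> ereal \<Rightarrow> (nat \<Rightarrow> real) set" where
  "normalized_ball n p = {y. if p = \<infinity> then \<forall>i\<in>{1..n}. \<bar>y i\<bar> \<le> 1
     else (\<Sum>i=1..n. \<bar>y i\<bar> powr real_of_ereal p) \<le> real n}"

text \<open>The strict inequality makes this an open condition on \<open>G\<close>, hence
  measurable, and comparisons of limits become inclusions of events.\<close>

definition exceeds :: "nat \<Rightarrow> ereal \<Rightarrow> real \<Rightarrow> (nat \<Rightarrow> nat \<Rightarrow> real) \<Rightarrow> bool" where
  "exceeds n p t G \<longleftrightarrow> (\<exists>y\<in>normalized_ball n p. quad_form n G y > t * real n powr (3/2))"

lemma normalized_ball_infinity [simp]:
  "y \<in> normalized_ball n \<infinity> \<longleftrightarrow> (\<forall>i\<in>{1..n}. \<bar>y i\<bar> \<le> 1)"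
  by (simp add: normalized_ball_def)

lemma normalized_ball_ereal [simp]:
  "y \<in> normalized_ball n (ereal r) \<longleftrightarrow> (\<Sum>i=1..n. \<bar>y i\<bar> powr r) \<le> real n"
  by (simp add: normalized_ball_def)

lemma normalized_ball_2:
  "y \<in> normalized_ball n 2 \<longleftrightarrow> (\<Sum>i=1..n. (y i)\<^sup>2) \<le> real n"
  using normalized_ball_ereal[of y n 2] by (simp del: normalized_ball_ereal)

text \<open>Weighted arithmetic-geometric mean inequality for \<open>x powr s\<close> and 1.\<close>

lemma powr_le_affine:
  fixes x r s :: real
  assumes "x \<ge> 0" "0 < r" "r \<le> s"
  shows "x powr r \<le> (r / s) * x powr s + (1 - r / s)"
proof (cases "x = 0")
  case False
  have "(x powr s) powr (r / s) * 1 powr (1 - r / s) \<le> (r / s) * x powr s + (1 - r / s) * 1"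
    by (rule Youngs_inequality_0) (use False assms in auto)
  then show ?thesis using assms by (simp add: powr_powr)
qed (use assms in auto)

text \<open>Monotonicity of power means, obtained by summing \<open>powr_le_affine\<close> over the
  coordinates.\<close>

lemma normalized_ball_antimono:
  assumes "0 < p" "p \<le> q"
  shows "normalized_ball n q \<subseteq> normalized_ball n p"
proof
  fix y assume y: "y \<in> normalized_ball n q"
  show "y \<in> normalized_ball n p"
  proof (cases p)
    case (real r)
    then have r: "r > 0" using assms by simp
    have "(\<Sum>i=1..n. \<bar>y i\<bar> powr r) \<le> real n"
    proof (cases q)
      case (real s)
      then have s: "r \<le> s" "(\<Sum>i=1..n. \<bar>y i\<bar> powr s) \<le> real n" using assms \<open>p = ereal r\<close> y by auto
      have "(\<Sum>i=1..n. \<bar>y i\<bar> powr r) \<le> (\<Sum>i=1..n. (r / s) * \<bar>y i\<bar> powr s + (1 - r / s))"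
        by (intro sum_mono powr_le_affine) (use r s in auto)
      also have "\<dots> = (r / s) * (\<Sum>i=1..n. \<bar>y i\<bar> powr s) + real n * (1 - r / s)"
        by (simp add: sum.distrib sum_distrib_left)
      also have "\<dots> \<le> (r / s) * real n + real n * (1 - r / s)"
        using r s by (intro add_right_mono mult_left_mono) auto
      also have "\<dots> = real n" by (simp add: algebra_simps)
      finally show ?thesis .
    next
      case PInf
      have "(\<Sum>i=1..n. \<bar>y i\<bar> powr r) \<le> (\<Sum>i=1..n. 1)"
        using y PInf r by (intro sum_mono) (auto intro!: powr_le1)
      then show ?thesis by simp
    qed (use assms in auto)
    then show ?thesis using real by simp
  qed (use assms y in auto)
qed

lemma quad_form_scale: "quad_form n G (\<lambda>i. c * x i) = c\<^sup>2 * quad_form n G x"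
  by (simp add: quad_form_def sum_distrib_left sum_distrib_right power2_eq_square mult_ac)

lemma quad_form_uminus: "quad_form n (\<lambda>i j. - G i j) x = - quad_form n G x"
  by (simp add: quad_form_def sum_negf)

lemma quad_form_cong:
  assumes "\<And>i j. i \<in> {1..n} \<Longrightarrow> j \<in> {1..n} \<Longrightarrow> G i j = H i j" "\<And>i. i \<in> {1..n} \<Longrightarrow> x i = y i"
  shows "quad_form n G x = quad_form n H y"
  unfolding quad_form_def by (intro sum.cong arg_cong2[where f="(*)"] refl assms)

text \<open>\<open>X\<close> collects both mixed sums, so no symmetry of \<open>G\<close> is
  involved. It does not depend on \<open>c\<close>, which allows bounding it from
  \<open>c = 1\<close> and \<open>c = -1\<close> and using it at another \<open>c\<close>.\<close>

lemma quad_form_add: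
  "\<exists>X. \<forall>c. quad_form n G (\<lambda>i. u i + c * w i) = quad_form n G u + c * X + c\<^sup>2 * quad_form n G w"
  by (intro exI[of _ "(\<Sum>i=1..n. (\<Sum>j=1..n. G i j * u j) * w i) + (\<Sum>i=1..n. (\<Sum>j=1..n. G i j * w j) * u i)"])
     (simp add: quad_form_def algebra_simps sum.distrib sum_distrib_left sum_distrib_right power2_eq_square)

lemma exceeds_cong:
  assumes "\<And>i j. i \<in> {1..n} \<Longrightarrow> j \<in> {1..n} \<Longrightarrow> G i j = H i j"
  shows "exceeds n p t G \<longleftrightarrow> exceeds n p t H"
  unfolding exceeds_def using quad_form_cong[of n G H, OF assms refl] by simp

lemma exceeds_antimono:
  assumes "0 < p" "p \<le> q" "exceeds n q t G"
  shows "exceeds n p t G"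
  using assms normalized_ball_antimono[OF assms(1,2), of n] unfolding exceeds_def by blast

section \<open>From the unit sphere to the normalized ball\<close>

lemma lp_norm_scale:
  assumes "n \<ge> 1" "2 \<le> p"
  shows "lp_norm n p (\<lambda>i. a * x i) = \<bar>a\<bar> * lp_norm n p x"
proof (cases "p = \<infinity>")
  case True
  have "mono (\<lambda>x. \<bar>a\<bar> * x)" by (intro monoI mult_left_mono) auto
  then have "\<bar>a\<bar> * Max ((\<lambda>i. \<bar>x i\<bar>) ` {1..n}) = Max ((\<lambda>x. \<bar>a\<bar> * x) ` (\<lambda>i. \<bar>x i\<bar>) ` {1..n})"
    by (rule mono_Max_commute) (use assms in auto)
  with True show ?thesis by (simp add: lp_norm_def image_image abs_mult)
next
  case False
  then obtain r where "p = ereal r" "r \<ge> 2" using assms by (cases p) auto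
  then show ?thesis
    by (simp add: lp_norm_def abs_mult powr_mult sum_distrib_left[symmetric] sum_nonneg powr_powr)
qed

lemma lp_norm_ge_coord:
  assumes "2 \<le> p" "i \<in> {1..n}"
  shows "\<bar>x i\<bar> \<le> lp_norm n p x"
proof (cases "p = \<infinity>")
  case True
  with assms show ?thesis by (auto simp: lp_norm_def intro!: Max_ge)
next
  case False
  then obtain r where r: "p = ereal r" "r \<ge> 2" using assms by (cases p) auto
  have "\<bar>x i\<bar> powr r \<le> (\<Sum>i=1..n. \<bar>x i\<bar> powr r)"
    using assms by (intro member_le_sum) auto
  then have "(\<bar>x i\<bar> powr r) powr (1 / r) \<le> (\<Sum>i=1..n. \<bar>x i\<bar> powr r) powr (1 / r)"
    using r by (intro powr_mono2) auto
  then show ?thesis using r by (simp add: lp_norm_def powr_powr)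
qed

lemma lp_norm_unit_vector:
  assumes "n \<ge> 1" "2 \<le> p"
  shows "lp_norm n p (\<lambda>i. if i = 1 then 1 else 0) = 1"
proof (cases "p = \<infinity>")
  case True
  have "Max ((\<lambda>i. \<bar>if i = 1 then 1 else 0 :: real\<bar>) ` {1..n}) = 1"
    using assms by (intro Max_eqI) (auto split: if_splits intro!: image_eqI[of _ _ 1])
  with True show ?thesis by (simp add: lp_norm_def)
next
  case False
  then obtain r where r: "p = ereal r" "r \<ge> 2" using assms by (cases p) auto
  have "(\<Sum>i=1..n. \<bar>if i = 1 then 1 else 0 :: real\<bar> powr r) = (\<Sum>i=1..n. if i = 1 then 1 else 0)"
    by (intro sum.cong) auto
  then show ?thesis using assms r by (simp add: lp_norm_def)
qed

text \<open>The exponent is \<open>1 / p\<close> for finite \<open>p\<close> and 0 for infinite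
  \<open>p\<close>, so one formula for the radius covers both cases.\<close>

lemma normalized_ball_iff_lp_norm:
  assumes "n \<ge> 1" "2 \<le> p"
  shows "y \<in> normalized_ball n p \<longleftrightarrow> lp_norm n p y \<le> real n powr (real_of_ereal (2 / p) / 2)"
proof (cases "p = \<infinity>")
  case True
  with assms show ?thesis by (auto simp: lp_norm_def)
next
  case False
  then obtain r where r: "p = ereal r" "r \<ge> 2" using assms by (cases p) auto
  define S where "S = (\<Sum>i=1..n. \<bar>y i\<bar> powr r)"
  have S: "S \<ge> 0" by (simp add: S_def sum_nonneg)
  have "S \<le> real n \<longleftrightarrow> S powr (1 / r) \<le> real n powr (1 / r)"
  proof
    assume "S powr (1 / r) \<le> real n powr (1 / r)"
    then have "(S powr (1 / r)) powr r \<le> (real n powr (1 / r)) powr r"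
      by (rule powr_mono2[rotated 2]) (use r in auto)
    then show "S \<le> real n" using r S by (simp add: powr_powr)
  qed (use r S in \<open>auto intro!: powr_mono2\<close>)
  moreover have "2 / ereal r = ereal (2 / r)" using r ereal_divide[of r 2] by simp
  ultimately show ?thesis using r by (simp add: lp_norm_def S_def)
qed

text \<open>Dilation by \<open>c\<close> maps the sphere into the ball. Conversely, as
  \<open>t\<close> is nonnegative, a vector of the ball above the level is nonzero, and pushing it
  out to the boundary cannot lose the inequality.\<close>

lemma less_GP_np_iff:
  assumes n: "n \<ge> 1" and p: "2 \<le> p" and t: "t \<ge> 0"
  shows "t < GP_np G n p \<longleftrightarrow> exceeds n p t G"
proof -
  define c where "c = real n powr (real_of_ereal (2 / p) / 2)"
  define e where "e = real n powr (3/2 - real_of_ereal (2 / p))"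
  have c: "c > 0" and e: "e > 0" using n by (auto simp: c_def e_def)
  have ce: "c\<^sup>2 * e = real n powr (3/2)"
    using n by (simp add: c_def e_def power2_eq_square flip: powr_add)
  let ?S = "{x. lp_norm n p x = 1}"
  have ne: "?S \<noteq> {}" using lp_norm_unit_vector[OF n p] by blast
  \<comment> \<open>The supremum is meaningful only for a bounded set; on the sphere every
    coordinate is at most 1 in absolute value.\<close>
  have "quad_form n G x / e \<le> (\<Sum>i=1..n. \<Sum>j=1..n. \<bar>G i j\<bar>) / e" if "x \<in> ?S" for x
  proof -
    have x: "\<bar>x i\<bar> \<le> 1" if "i \<in> {1..n}" for i
      using lp_norm_ge_coord[OF p that, of x] \<open>x \<in> ?S\<close> by simp
    have "G i j * x j * x i \<le> \<bar>G i j\<bar>" if "i \<in> {1..n}" "j \<in> {1..n}" for i j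
    proof -
      have "\<bar>G i j * x j * x i\<bar> \<le> \<bar>G i j\<bar> * 1 * 1"
        unfolding abs_mult using x that by (intro mult_mono) auto
      then show ?thesis by simp
    qed
    then show ?thesis unfolding quad_form_def sum_distrib_right
      using e by (intro divide_right_mono sum_mono) auto
  qed
  then have bdd: "bdd_above ((\<lambda>x. quad_form n G x / e) ` ?S)"
    by (intro bdd_aboveI2)
  have "t < GP_np G n p \<longleftrightarrow> (\<exists>x\<in>?S. t < quad_form n G x / e)"
    unfolding GP_np_def e_def[symmetric] by (rule less_cSUP_iff[OF ne bdd])
  also have "\<dots> \<longleftrightarrow> exceeds n p t G"
  proof
    assume "\<exists>x\<in>?S. t < quad_form n G x / e"
    then obtain x where x: "lp_norm n p x = 1" "t < quad_form n G x / e" by blast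
    have "lp_norm n p (\<lambda>i. c * x i) = c" using x c by (simp add: lp_norm_scale[OF n p])
    then have "(\<lambda>i. c * x i) \<in> normalized_ball n p"
      by (simp add: normalized_ball_iff_lp_norm[OF n p] c_def)
    moreover have "t * real n powr (3/2) < quad_form n G (\<lambda>i. c * x i)"
    proof -
      have "t * e < quad_form n G x" using x e by (simp add: field_simps)
      then have "c\<^sup>2 * (t * e) < c\<^sup>2 * quad_form n G x" using c by simp
      then show ?thesis by (simp add: quad_form_scale ce[symmetric] mult_ac)
    qed
    ultimately show "exceeds n p t G" unfolding exceeds_def by blast
  next
    assume "exceeds n p t G"
    then obtain y where y: "lp_norm n p y \<le> c" "t * (c\<^sup>2 * e) < quad_form n G y"
      unfolding exceeds_def ce by (auto simp: normalized_ball_iff_lp_norm[OF n p] c_def)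
    define s where "s = lp_norm n p y"
    have "0 < quad_form n G y"
      using y(2) t e by (smt (verit) mult_nonneg_nonneg zero_le_power2)
    have "s > 0"
    proof (rule ccontr)
      assume "\<not> s > 0"
      then have "y i = 0" if "i \<in> {1..n}" for i
        using lp_norm_ge_coord[OF p that, of y] by (simp add: s_def)
      then have "quad_form n G y = 0" by (simp add: quad_form_def)
      with \<open>0 < quad_form n G y\<close> show False by simp
    qed
    then have "lp_norm n p (\<lambda>i. (1 / s) * y i) = 1"
      by (simp only: lp_norm_scale[OF n p]) (simp add: s_def)
    moreover have "t < quad_form n G (\<lambda>i. (1 / s) * y i) / e"
    proof -
      have "s\<^sup>2 \<le> c\<^sup>2" using y(1) \<open>s > 0\<close> by (intro power_mono) (auto simp: s_def)
      then have "t * (s\<^sup>2 * e) \<le> t * (c\<^sup>2 * e)" using t e by (intro mult_left_mono mult_right_mono) auto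
      with y(2) have "t * (s\<^sup>2 * e) < quad_form n G y" by simp
      then show ?thesis unfolding quad_form_scale using \<open>s > 0\<close> e
        by (simp add: field_simps)
    qed
    ultimately show "\<exists>x\<in>?S. t < quad_form n G x / e" by blast
  qed
  finally show ?thesis .
qed

text \<open>By homogeneity, the bound on one Euclidean ball is a bound for all vectors.\<close>

lemma quad_form_le_of_not_exceeds:
  assumes n: "n \<ge> 1" and C: "\<not> exceeds n 2 C G"
  shows "quad_form n G w \<le> C * sqrt n * (\<Sum>i=1..n. (w i)\<^sup>2)"
proof (cases "(\<Sum>i=1..n. (w i)\<^sup>2) = 0")
  case True
  then have "w i = 0" if "i \<in> {1..n}" for i
    using that by (simp add: sum_nonneg_eq_0_iff)
  then have "quad_form n G w = 0" by (simp add: quad_form_def)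
  then show ?thesis using True by simp
next
  case False
  define S where "S = (\<Sum>i=1..n. (w i)\<^sup>2)"
  have S: "S > 0" using False sum_nonneg[of "{1..n}" "\<lambda>i. (w i)\<^sup>2"] by (simp add: S_def)
  define c where "c = sqrt (n / S)"
  have c2: "c\<^sup>2 = n / S" using S by (simp add: c_def)
  have "(\<Sum>i=1..n. (c * w i)\<^sup>2) = c\<^sup>2 * S"
    by (simp add: S_def sum_distrib_left power_mult_distrib)
  then have "(\<lambda>i. c * w i) \<in> normalized_ball n 2"
    using S by (simp add: normalized_ball_2 c2)
  then have "c\<^sup>2 * quad_form n G w \<le> C * n powr (3/2)"
    using C unfolding exceeds_def quad_form_scale[symmetric] by (meson not_less)
  also have "n powr (3/2) = n * sqrt n"
    using n powr_add[of "real n" 1 "1/2"] by (simp add: powr_half_sqrt)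
  finally have "(n / S) * quad_form n G w \<le> (n / S) * (C * sqrt n * S)"
    using S by (simp add: c2 mult_ac)
  then show ?thesis using n S unfolding S_def[symmetric] by (subst (asm) mult_le_cancel_left_pos) auto
qed

text \<open>Cutting a vector at level \<open>K\<close>: the small part lies in a slightly dilated \<open>q\<close>-ball, and the
  large part has small Euclidean norm because \<open>r > 2\<close>.\<close>

lemma quad_form_truncation:
  fixes r :: real and q :: ereal
  assumes n: "n \<ge> 1" and r: "2 \<le> r" "ereal r < q" and K: "K \<ge> 1" and C: "C \<ge> 0"
    and y: "y \<in> normalized_ball n (ereal r)"
    and t: "\<not> exceeds n q t G" and C1: "\<not> exceeds n 2 C G" and C2: "\<not> exceeds n 2 C (\<lambda>i j. - G i j)"
  shows "quad_form n G y \<le> ((K powr (1 - real_of_ereal (ereal r / q)))\<^sup>2 * t + 3 * C * K powr ((2 - r) / 2))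
           * real n powr (3/2)"
proof -
  define \<kappa> where "\<kappa> = K powr (1 - real_of_ereal (ereal r / q))"
  define \<delta> where "\<delta> = K powr ((2 - r) / 2)"
  define N where "N = real n powr (3/2)"
  have N: "N = n * sqrt n"
    using n powr_add[of "real n" 1 "1/2"] by (simp add: powr_half_sqrt N_def)
  have \<kappa>: "\<kappa> > 0" and \<delta>: "\<delta> > 0" using K by (auto simp: \<kappa>_def \<delta>_def)
  have \<delta>1: "\<delta> \<le> 1"
    using powr_mono[of "(2 - r) / 2" 0 K] K r by (simp add: \<delta>_def)
  have \<delta>2: "\<delta>\<^sup>2 = K powr (2 - r)"
    using K by (simp add: \<delta>_def power2_eq_square flip: powr_add)
  define u where "u i = (if \<bar>y i\<bar> \<le> K then y i else 0)" for i
  \<comment> \<open>Division by \<open>\<delta>\<close> brings the large part to the scale of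
    \<open>u\<close>: both have squared norm at most \<open>n\<close>, and the smallness sits in the
    factor \<open>\<delta>\<close>.\<close>
  define w where "w i = (if \<bar>y i\<bar> \<le> K then 0 else y i / \<delta>)" for i
  have y_eq: "y = (\<lambda>i. u i + \<delta> * w i)" using \<delta> by (auto simp: u_def w_def)
  have "y \<in> normalized_ball n 2"
    using normalized_ball_antimono[of 2 "ereal r" n] r y by auto
  then have "(\<Sum>i=1..n. (y i)\<^sup>2) \<le> n" by (simp add: normalized_ball_2)
  moreover have "(\<Sum>i=1..n. (u i)\<^sup>2) \<le> (\<Sum>i=1..n. (y i)\<^sup>2)"
    by (intro sum_mono) (auto simp: u_def)
  ultimately have u2: "(\<Sum>i=1..n. (u i)\<^sup>2) \<le> n" by simp
  have w2: "(\<Sum>i=1..n. (w i)\<^sup>2) \<le> n"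
  proof -
    have "(w i)\<^sup>2 \<le> \<bar>y i\<bar> powr r" for i
    proof (cases "\<bar>y i\<bar> \<le> K")
      case False
      then have yi: "\<bar>y i\<bar> > 0" using K by simp
      have "(y i)\<^sup>2 = \<bar>y i\<bar> powr (2 - r) * \<bar>y i\<bar> powr r"
        using yi by (simp flip: powr_add)
      also have "\<dots> \<le> K powr (2 - r) * \<bar>y i\<bar> powr r"
        using False K r by (intro mult_right_mono powr_mono2') auto
      finally show ?thesis
        using \<delta> False by (simp add: w_def power_divide divide_le_eq \<delta>2[symmetric] mult.commute)
    qed (simp add: w_def)
    then have "(\<Sum>i=1..n. (w i)\<^sup>2) \<le> (\<Sum>i=1..n. \<bar>y i\<bar> powr r)" by (intro sum_mono)
    with y show ?thesis by simp
  qed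
  have "(\<lambda>i. (1 / \<kappa>) * u i) \<in> normalized_ball n q"
  proof (cases q)
    case (real s)
    then have s: "s > r" using r by simp
    have \<kappa>s: "\<kappa> powr s = K powr (s - r)"
      using s r real by (simp add: \<kappa>_def powr_powr algebra_simps)
    have "\<bar>(1 / \<kappa>) * u i\<bar> powr s \<le> \<bar>y i\<bar> powr r" for i
    proof (cases "\<bar>y i\<bar> \<le> K \<and> y i \<noteq> 0")
      case True
      have "\<bar>y i\<bar> powr s = \<bar>y i\<bar> powr (s - r) * \<bar>y i\<bar> powr r"
        using True by (simp flip: powr_add)
      also have "\<dots> \<le> K powr (s - r) * \<bar>y i\<bar> powr r"
        using True s by (intro mult_right_mono powr_mono2) auto
      finally have "\<bar>y i\<bar> powr s \<le> \<kappa> powr s * \<bar>y i\<bar> powr r" by (simp add: \<kappa>s)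
      then show ?thesis using \<kappa> True by (simp add: u_def powr_divide abs_mult divide_le_eq mult.commute)
    qed (auto simp: u_def)
    then have "(\<Sum>i=1..n. \<bar>(1 / \<kappa>) * u i\<bar> powr s) \<le> (\<Sum>i=1..n. \<bar>y i\<bar> powr r)" by (intro sum_mono)
    with y real show ?thesis by simp
  next
    case PInf
    \<comment> \<open>Here \<open>ereal r / q\<close> is 0, so \<open>\<kappa>\<close> is the
      cutting level itself.\<close>
    then have "\<kappa> = K" using K by (simp add: \<kappa>_def)
    with PInf K show ?thesis by (auto simp: u_def abs_mult)
  qed (use r in auto)
  then have "quad_form n G (\<lambda>i. (1 / \<kappa>) * u i) \<le> t * N"
    using t unfolding exceeds_def N_def by (meson not_less)
  then have qu: "quad_form n G u \<le> \<kappa>\<^sup>2 * t * N"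
    unfolding quad_form_scale using \<kappa> by (simp add: field_simps power2_eq_square)
  obtain X where X: "\<And>c. quad_form n G (\<lambda>i. u i + c * w i) = quad_form n G u + c * X + c\<^sup>2 * quad_form n G w"
    using quad_form_add by metis
  note le = quad_form_le_of_not_exceeds[OF n C1] quad_form_le_of_not_exceeds[OF n C2, unfolded quad_form_uminus]
  \<comment> \<open>Polarization bounds the mixed term: \<open>2 * X\<close> is a difference of two
    values of the form. The subtracted value needs a lower bound, which is where \<open>- G\<close>
    enters, and the parallelogram law adds up the norms.\<close>
  have par: "(\<Sum>i=1..n. (u i + 1 * w i)\<^sup>2) + (\<Sum>i=1..n. (u i + (-1) * w i)\<^sup>2)
      = 2 * (\<Sum>i=1..n. (u i)\<^sup>2) + 2 * (\<Sum>i=1..n. (w i)\<^sup>2)"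
    by (simp add: sum.distrib[symmetric] sum_distrib_left power2_eq_square algebra_simps)
  have "2 * X = quad_form n G (\<lambda>i. u i + 1 * w i) - quad_form n G (\<lambda>i. u i + (-1) * w i)"
    unfolding X by simp
  also have "\<dots> \<le> C * sqrt n * (\<Sum>i=1..n. (u i + 1 * w i)\<^sup>2) + C * sqrt n * (\<Sum>i=1..n. (u i + (-1) * w i)\<^sup>2)"
    using le(1)[of "\<lambda>i. u i + 1 * w i"] le(2)[of "\<lambda>i. u i + (-1) * w i"] by linarith
  also have "\<dots> = C * sqrt n * (2 * (\<Sum>i=1..n. (u i)\<^sup>2) + 2 * (\<Sum>i=1..n. (w i)\<^sup>2))"
    unfolding par[symmetric] by (simp add: distrib_left)
  also have "\<dots> \<le> C * sqrt n * (4 * n)"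
    using u2 w2 C by (intro mult_left_mono) auto
  finally have X2: "X \<le> 2 * C * N" by (simp add: N mult_ac)
  have "quad_form n G w \<le> C * sqrt n * (\<Sum>i=1..n. (w i)\<^sup>2)" by (rule le(1))
  also have "\<dots> \<le> C * sqrt n * n" using w2 C by (intro mult_left_mono) auto
  finally have W: "quad_form n G w \<le> C * N" by (simp add: N mult_ac)
  have CN: "C * N \<ge> 0" using C by (simp add: N)
  have "quad_form n G y = quad_form n G u + \<delta> * X + \<delta>\<^sup>2 * quad_form n G w"
    unfolding y_eq by (rule X)
  also have "\<dots> \<le> \<kappa>\<^sup>2 * t * N + \<delta> * (2 * C * N) + \<delta>\<^sup>2 * (C * N)"
    using qu X2 W \<delta> by (intro add_mono mult_left_mono) auto
  \<comment> \<open>Since \<open>\<delta>\<close> is at most 1, the last term merges with the mixed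
    term and yields the constant 3.\<close>
  also have "\<delta>\<^sup>2 * (C * N) \<le> \<delta> * (C * N)"
    using \<delta> \<delta>1 CN by (intro mult_right_mono) (auto simp: power2_eq_square mult_le_cancel_left1)
  finally show ?thesis by (simp add: \<kappa>_def[symmetric] \<delta>_def[symmetric] N_def[symmetric] algebra_simps)
qed

text \<open>The union over \<open>y\<close> is uncountable, but its members are open in the product
  topology, so the union is open and hence Borel.\<close>

lemma sets_exceeds:
  "{z \<in> space (gauss ({1..n} \<times> {1..n})). exceeds n p t (curry z)} \<in> sets (gauss ({1..n} \<times> {1..n}))"
proof -
  let ?I = "{1..n} \<times> {1..n}"
  define W where "W = (\<Union>y\<in>normalized_ball n p. {z :: nat \<times> nat \<Rightarrow> real. t * real n powr (3/2) < quad_form n (curry z) y})"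
  have "open W" unfolding W_def quad_form_def curry_def
    by (intro open_UN ballI open_Collect_less continuous_intros continuous_on_product_coordinates)
  then have W: "W \<in> sets (PiM UNIV (\<lambda>_. borel))" by (simp add: sets_PiM_equal_borel)
  \<comment> \<open>Extension by 0 leads to functions on all index pairs, where the Borel sets of
    the product topology are those of the product sigma-algebra.\<close>
  define E where "E z = (\<lambda>i. if i \<in> ?I then z i else 0)" for z :: "nat \<times> nat \<Rightarrow> real"
  have [measurable]: "E \<in> measurable (gauss ?I) (PiM UNIV (\<lambda>_. borel))"
    unfolding E_def
  proof (rule measurable_PiM_single')
    fix i :: "nat \<times> nat"
    show "(\<lambda>z. if i \<in> ?I then z i else 0) \<in> borel_measurable (gauss ?I)"
      by (cases "i \<in> ?I") (auto simp: gauss_def measurable_component_singleton cong: measurable_cong_sets)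
  qed auto
  have "{z \<in> space (gauss ?I). exceeds n p t (curry z)} = E -` W \<inter> space (gauss ?I)"
  proof -
    have "exceeds n p t (curry z) \<longleftrightarrow> exceeds n p t (curry (E z))" for z
      by (rule exceeds_cong) (simp add: E_def)
    moreover have "exceeds n p t (curry z) \<longleftrightarrow> z \<in> W" for z
      by (auto simp: exceeds_def W_def)
    ultimately show ?thesis by auto
  qed
  also have "\<dots> \<in> sets (gauss ?I)" using W by measurable
  finally show ?thesis .
qed


subsection \<open>Exceedance probabilities\<close>

definition exceed_set :: "nat \<Rightarrow> ereal \<Rightarrow> real \<Rightarrow> (nat \<times> nat \<Rightarrow> real) set" where
  "exceed_set n p t = {z \<in> space (gauss (idx n)). exceeds n p t (curry z)}"

definition exceed_prob :: "nat \<Rightarrow> ereal \<Rightarrow> real \<Rightarrow> real" where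
  "exceed_prob n p t = measure (gauss (idx n)) (exceed_set n p t)"

lemma exceed_set_measurable [measurable]: "exceed_set n p t \<in> sets (gauss (idx n))"
  unfolding exceed_set_def by (rule sets_exceeds)

lemma exceed_set_antimono:
  assumes "0 < p" "p \<le> q"
  shows "exceed_set n q t \<subseteq> exceed_set n p t"
  using exceeds_antimono[OF assms] unfolding exceed_set_def by auto

text \<open>Symmetry of the law under \<open>G\<close> to \<open>- G\<close>: upper bounds on the
  form also control it from below.\<close>

lemma
  shows sets_exceeds_uminus:
      "{z \<in> space (gauss (idx n)). exceeds n p t (\<lambda>i j. - z (i, j))} \<in> sets (gauss (idx n))"
    and measure_exceeds_uminus:
      "measure (gauss (idx n)) {z \<in> space (gauss (idx n)). exceeds n p t (\<lambda>i j. - z (i, j))} = exceed_prob n p t"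
proof -
  define S where "S z = (\<lambda>q\<in>idx n. (- 1) * z q)" for z :: "nat \<times> nat \<Rightarrow> real"
  have S: "preserves (gauss (idx n)) S"
    unfolding S_def by (rule preserves_gauss_sign) auto
  then have Sm: "S \<in> measurable (gauss (idx n)) (gauss (idx n))"
    by (simp add: preserves_def)
  have "exceeds n p t (curry (S z)) \<longleftrightarrow> exceeds n p t (\<lambda>i j. - z (i, j))" for z
    by (rule exceeds_cong) (simp add: S_def)
  then have eq: "{z \<in> space (gauss (idx n)). exceeds n p t (\<lambda>i j. - z (i, j))}
      = S -` exceed_set n p t \<inter> space (gauss (idx n))"
    using measurable_space[OF Sm] by (auto simp: exceed_set_def)
  show "{z \<in> space (gauss (idx n)). exceeds n p t (\<lambda>i j. - z (i, j))} \<in> sets (gauss (idx n))"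
    unfolding eq by (rule measurable_sets[OF Sm exceed_set_measurable])
  show "measure (gauss (idx n)) {z \<in> space (gauss (idx n)). exceeds n p t (\<lambda>i j. - z (i, j))} = exceed_prob n p t"
    unfolding eq exceed_prob_def by (rule preserves_measure[OF S exceed_set_measurable])
qed

text \<open>Weighted arithmetic-geometric mean inequality with weight \<open>(q - 2) / 2\<close>,
  the one for which the exponents 2 and 4 average to \<open>q\<close>.\<close>

lemma powr_interpolation_2_4:
  fixes x q :: real
  assumes "2 \<le> q" "q \<le> 4" "x \<ge> 0"
  shows "x powr q \<le> (1 - (q - 2) / 2) * x\<^sup>2 + ((q - 2) / 2) * x ^ 4"
proof (cases "x = 0")
  case False
  then have x: "x > 0" using assms by simp
  have "(x\<^sup>2) powr (1 - (q - 2) / 2) * (x ^ 4) powr ((q - 2) / 2)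
      \<le> (1 - (q - 2) / 2) * x\<^sup>2 + ((q - 2) / 2) * x ^ 4"
    by (rule Youngs_inequality_0) (use assms x in auto)
  moreover have "(x\<^sup>2) powr (1 - (q - 2) / 2) * (x ^ 4) powr ((q - 2) / 2) = x powr q"
  proof -
    have "x\<^sup>2 = x powr 2" "x ^ 4 = x powr 4"
      using x powr_realpow[of x 2] powr_realpow[of x 4] by simp_all
    then have "(x\<^sup>2) powr (1 - (q - 2) / 2) * (x ^ 4) powr ((q - 2) / 2)
        = x powr (2 * (1 - (q - 2) / 2) + 4 * ((q - 2) / 2))"
      by (simp only: powr_powr powr_add)
    also have "2 * (1 - (q - 2) / 2) + 4 * ((q - 2) / 2) = q" by (simp add: field_simps)
    finally show ?thesis .
  qed
  ultimately show ?thesis by simp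
qed auto

text \<open>Randomly signed Hadamard rotations flatten every vector: for most signs the \<open>q\<close>-norm, \<open>q\<close> close
  to 2, is almost the Euclidean norm. As the law of the matrix is rotation invariant, a good vector
  for \<open>p = 2\<close> may be replaced by a flat one.\<close>

lemma exceed_prob_2_le:
  fixes q \<eta> t :: real
  assumes n: "n = 2 ^ k" and q: "2 \<le> q" "q \<le> 4" and \<eta>: "\<eta> > 0"
  shows "(\<eta> - (q - 2)) / (1 + \<eta>) * exceed_prob n 2 t \<le> exceed_prob n (ereal q) (t / (1 + \<eta>)\<^sup>2)"
proof -
  define \<theta> where "\<theta> = (q - 2) / 2"
  \<comment> \<open>The mean over signs of the sum of \<open>q\<close>-th powers is at most
    \<open>(1 + (q - 2)) * n\<close>; by Markov's inequality at level
    \<open>(1 + \<eta>) * n\<close>, at least the fraction \<open>c\<close> of all signs is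
    good.\<close>
  define c where "c = (\<eta> - (q - 2)) / (1 + \<eta>)"
  define P where "P = Pow {1..n}"
  let ?\<mu> = "gauss (idx n)"
  interpret \<mu>: prob_space ?\<mu> by (rule prob_space_gauss)
  have n0: "real n > 0" by (simp add: n)
  obtain L \<rho> where L: "gauss_rot n L"
      "\<And>x i. i \<in> {1..n} \<Longrightarrow> L x i = (\<Sum>j=1..n. \<rho> i j * x j) / sqrt (2 ^ k)"
      "\<And>i j. i \<in> {1..n} \<Longrightarrow> j \<in> {1..n} \<Longrightarrow> \<bar>\<rho> i j\<bar> = (1::real)"
    using hadamard_rot[of "{1..n}" n k] n by auto
  define R where "R T x = L (\<lambda>i. flip_sign T i * x i)" for T x
  have "gauss_rot n (R T)" for T
    unfolding R_def by (rule gauss_rot_comp[OF L(1) gauss_rot_sign]) simp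
  then have "\<forall>T. \<exists>S. preserves ?\<mu> S \<and> (\<forall>z x. quad_form n (curry (S z)) (R T x) = quad_form n (curry z) x)"
    unfolding gauss_rot_def by simp
  then obtain S where S: "\<And>T. preserves ?\<mu> (S T)"
      "\<And>T z x. quad_form n (curry (S T z)) (R T x) = quad_form n (curry z) x"
    by metis
  have Sm [measurable]: "S T \<in> measurable ?\<mu> ?\<mu>" for T using S(1) by (simp add: preserves_def)
  have cardP: "card P = 2 ^ n" and finP: "finite P" by (simp_all add: P_def card_Pow)
  define E where "E = exceed_set n (ereal q) (t / (1 + \<eta>)\<^sup>2)"
  have [measurable]: "E \<in> sets ?\<mu>"
    unfolding E_def by (rule exceed_set_measurable)

  \<comment> \<open>For each fixed matrix the good sign patterns are counted; integrating over the
    matrix comes afterwards, so \<open>y\<close> may depend on \<open>z\<close>.\<close>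
  have good: "2 ^ n * c \<le> (\<Sum>T\<in>P. indicator E (S T z))" if z: "z \<in> exceed_set n 2 t" for z
  proof -
    obtain y :: "nat \<Rightarrow> real" where y: "(\<Sum>i=1..n. (y i)\<^sup>2) \<le> n" "quad_form n (curry z) y > t * real n powr (3/2)"
      using z by (auto simp: exceed_set_def exceeds_def normalized_ball_2)
    have R: "R T y i = (\<Sum>j=1..n. flip_sign T j * (\<rho> i j * y j / sqrt n))" if "i \<in> {1..n}" for T i
      unfolding R_def L(2)[OF that] sum_divide_distrib using n by (intro sum.cong) auto
    have a2: "(\<Sum>j=1..n. (\<rho> i j * y j / sqrt n)\<^sup>2) \<le> 1" if "i \<in> {1..n}" for i
    proof -
      have "(\<rho> i j * y j / sqrt n)\<^sup>2 = (y j)\<^sup>2 / n" if "j \<in> {1..n}" for j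
      proof -
        have "(\<rho> i j)\<^sup>2 = 1" using L(3)[OF \<open>i \<in> {1..n}\<close> that] by (metis power2_abs one_power2)
        then show ?thesis by (simp add: power_divide power_mult_distrib)
      qed
      then have "(\<Sum>j=1..n. (\<rho> i j * y j / sqrt n)\<^sup>2) = (\<Sum>j=1..n. (y j)\<^sup>2) / n"
        by (simp add: sum_divide_distrib)
      with y(1) n0 show ?thesis by simp
    qed
    define h where "h T = (\<Sum>i=1..n. \<bar>R T y i\<bar> powr q)" for T
    \<comment> \<open>The second moment is at most 1 and the fourth at most 3, so the interpolation
      gives \<open>(1 - \<theta>) + 3 * \<theta>\<close>.\<close>
    have hi: "(\<Sum>T\<in>P. \<bar>R T y i\<bar> powr q) \<le> 2 ^ n * (1 + 2 * \<theta>)" if i: "i \<in> {1..n}" for i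
    proof -
      let ?a = "\<lambda>j. \<rho> i j * y j / sqrt n"
      have nn: "(\<Sum>j=1..n. (?a j)\<^sup>2) \<ge> 0" by (intro sum_nonneg) simp
      have "(\<Sum>T\<in>P. (R T y i)\<^sup>2) = 2 ^ n * (\<Sum>j=1..n. (?a j)\<^sup>2)"
        unfolding P_def R[OF i] by (subst sum_flip_sign_square) simp_all
      also have "\<dots> \<le> 2 ^ n * 1" using a2[OF i] by (intro mult_left_mono) auto
      finally have m2: "(\<Sum>T\<in>P. (R T y i)\<^sup>2) \<le> 2 ^ n" by simp
      have "(\<Sum>T\<in>P. (R T y i) ^ 4) \<le> 3 * 2 ^ n * (\<Sum>j=1..n. (?a j)\<^sup>2)\<^sup>2"
        unfolding P_def R[OF i] using sum_flip_sign_power4[of "{1..n}" ?a] by simp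
      also have "\<dots> \<le> 3 * 2 ^ n * 1"
        using a2[OF i] nn by (intro mult_left_mono) (auto simp: power_le_one)
      finally have m4: "(\<Sum>T\<in>P. (R T y i) ^ 4) \<le> 3 * 2 ^ n" by simp
      have "(\<Sum>T\<in>P. \<bar>R T y i\<bar> powr q) \<le> (\<Sum>T\<in>P. (1 - \<theta>) * (R T y i)\<^sup>2 + \<theta> * (R T y i) ^ 4)"
      proof (rule sum_mono)
        fix T
        show "\<bar>R T y i\<bar> powr q \<le> (1 - \<theta>) * (R T y i)\<^sup>2 + \<theta> * (R T y i) ^ 4"
          using powr_interpolation_2_4[OF q, of "\<bar>R T y i\<bar>"] by (simp add: \<theta>_def power_even_abs)
      qed
      also have "\<dots> = (1 - \<theta>) * (\<Sum>T\<in>P. (R T y i)\<^sup>2) + \<theta> * (\<Sum>T\<in>P. (R T y i) ^ 4)"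
        by (simp add: sum.distrib sum_distrib_left)
      also have "\<dots> \<le> (1 - \<theta>) * 2 ^ n + \<theta> * (3 * 2 ^ n)"
        using m2 m4 q by (intro add_mono mult_left_mono) (auto simp: \<theta>_def)
      finally show ?thesis by (simp add: algebra_simps)
    qed
    have "(\<Sum>T\<in>P. h T) = (\<Sum>i=1..n. \<Sum>T\<in>P. \<bar>R T y i\<bar> powr q)"
      unfolding h_def by (rule sum.swap)
    also have "\<dots> \<le> (\<Sum>i=1..n. 2 ^ n * (1 + 2 * \<theta>))" by (intro sum_mono hi)
    finally have hsum: "(\<Sum>T\<in>P. h T) \<le> n * (2 ^ n * (1 + 2 * \<theta>))" by simp
    have hnn: "h T \<ge> 0" for T by (simp add: h_def sum_nonneg)
    \<comment> \<open>Markov's inequality in pointwise form: the left side is at most 1, and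
      negative when the flattened vector is too long.\<close>
    have ind: "1 - h T / ((1 + \<eta>) * n) \<le> indicator E (S T z)" if "T \<in> P" for T
    proof (cases "h T \<le> (1 + \<eta>) * n")
      case True
      define x where "x i = (1 / (1 + \<eta>)) * R T y i" for i
      have "(\<Sum>i=1..n. \<bar>x i\<bar> powr q) = (\<Sum>i=1..n. (1 / (1 + \<eta>)) powr q * \<bar>R T y i\<bar> powr q)"
        using \<eta> by (intro sum.cong refl) (simp add: x_def abs_mult powr_divide)
      also have "\<dots> = (1 / (1 + \<eta>)) powr q * h T"
        by (simp add: h_def sum_distrib_left)
      also have "\<dots> \<le> (1 / (1 + \<eta>)) powr 1 * ((1 + \<eta>) * n)"
        using True hnn \<eta> q by (intro mult_mono powr_mono') auto
      also have "\<dots> = n" using \<eta> by simp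
      finally have "x \<in> normalized_ball n (ereal q)" by simp
      moreover have "t / (1 + \<eta>)\<^sup>2 * real n powr (3/2) < quad_form n (curry (S T z)) x"
      proof -
        have "quad_form n (curry (S T z)) x = (1 / (1 + \<eta>))\<^sup>2 * quad_form n (curry z) y"
          unfolding x_def quad_form_scale S(2) ..
        also have "\<dots> > (1 / (1 + \<eta>))\<^sup>2 * (t * real n powr (3/2))"
          using y(2) \<eta> by (intro mult_strict_left_mono) auto
        finally show ?thesis by (simp add: power_divide)
      qed
      moreover have "S T z \<in> space ?\<mu>"
        using measurable_space[OF Sm] z by (simp add: exceed_set_def)
      ultimately have "S T z \<in> E" by (auto simp: E_def exceed_set_def exceeds_def)
      then show ?thesis using hnn[of T] \<eta> by simp
    next
      case False
      moreover have "(1 + \<eta>) * n > 0" using n0 \<eta> by simp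
      ultimately have "1 \<le> h T / ((1 + \<eta>) * n)" using le_divide_eq_1_pos by fastforce
      then have "1 - h T / ((1 + \<eta>) * n) \<le> 0" by simp
      also have "0 \<le> (indicator E (S T z) :: real)" by simp
      finally show ?thesis .
    qed
    have "c = 1 - (1 + 2 * \<theta>) / (1 + \<eta>)"
      using \<eta> by (simp add: c_def \<theta>_def field_simps)
    then have "2 ^ n * c = 2 ^ n - n * (2 ^ n * (1 + 2 * \<theta>)) / ((1 + \<eta>) * n)"
      using n0 by (simp add: right_diff_distrib)
    also have "\<dots> \<le> 2 ^ n - (\<Sum>T\<in>P. h T) / ((1 + \<eta>) * n)"
      using hsum \<eta> by (intro diff_left_mono divide_right_mono) auto
    also have "\<dots> = (\<Sum>T\<in>P. 1 - h T / ((1 + \<eta>) * n))"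
      by (simp add: sum_subtractf cardP sum_divide_distrib)
    also have "\<dots> \<le> (\<Sum>T\<in>P. indicator E (S T z))" by (intro sum_mono ind)
    finally show ?thesis .
  qed

  have Es: "E \<inter> space ?\<mu> = E" by (auto simp: E_def exceed_set_def)
  have int: "integrable ?\<mu> (\<lambda>z. indicator E (S T z) :: real)" for T
  proof (rule \<mu>.integrable_const_bound[where B = 1])
    show "AE z in ?\<mu>. norm (indicator E (S T z) :: real) \<le> 1" by (simp add: indicator_def)
  qed measurable
  have pw: "2 ^ n * c * indicator (exceed_set n 2 t) z \<le> (\<Sum>T\<in>P. indicator E (S T z) :: real)" for z
    using good[of z] by (cases "z \<in> exceed_set n 2 t") (auto intro!: sum_nonneg)
  have "exceed_set n 2 t \<inter> space ?\<mu> = exceed_set n 2 t" by (auto simp: exceed_set_def)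
  then have "2 ^ n * (c * exceed_prob n 2 t) = (\<integral>z. 2 ^ n * c * indicator (exceed_set n 2 t) z \<partial>?\<mu>)"
    by (simp add: exceed_prob_def)
  also have "\<dots> \<le> (\<integral>z. (\<Sum>T\<in>P. indicator E (S T z)) \<partial>?\<mu>)"
  proof (rule integral_mono)
    show "integrable ?\<mu> (\<lambda>z. \<Sum>T\<in>P. indicator E (S T z) :: real)"
      by (intro Bochner_Integration.integrable_sum int)
    show "integrable ?\<mu> (\<lambda>z. 2 ^ n * c * indicator (exceed_set n 2 t) z)"
      by (rule integrable_mult_right, rule integrable_real_indicator, rule exceed_set_measurable)
         (use \<mu>.emeasure_finite in \<open>simp add: less_top[symmetric]\<close>)
  qed (rule pw)
  also have "\<dots> = (\<Sum>T\<in>P. (\<integral>z. indicator E (S T z) \<partial>?\<mu>))"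
    by (intro Bochner_Integration.integral_sum int)
  \<comment> \<open>By invariance of the law, every sign pattern contributes the same
    probability.\<close>
  also have "\<dots> = (\<Sum>T\<in>P. exceed_prob n (ereal q) (t / (1 + \<eta>)\<^sup>2))"
  proof (intro sum.cong refl)
    fix T
    have "(\<integral>z. (indicator E (S T z) :: real) \<partial>?\<mu>) = (\<integral>z. indicator E z \<partial>distr ?\<mu> ?\<mu> (S T))"
      by (rule integral_distr[symmetric]) measurable
    also have "distr ?\<mu> ?\<mu> (S T) = ?\<mu>" using S(1) by (simp add: preserves_def)
    finally show "(\<integral>z. indicator E (S T z) \<partial>?\<mu>) = exceed_prob n (ereal q) (t / (1 + \<eta>)\<^sup>2)"
      using Es by (simp add: exceed_prob_def E_def[symmetric])
  qed
  also have "\<dots> = 2 ^ n * exceed_prob n (ereal q) (t / (1 + \<eta>)\<^sup>2)" by (simp add: cardP)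
  finally have "c * exceed_prob n 2 t \<le> exceed_prob n (ereal q) (t / (1 + \<eta>)\<^sup>2)"
    by (rule mult_left_le_imp_le) simp
  then show ?thesis unfolding c_def .
qed

subsection \<open>Continuity of the limit\<close>

text \<open>The limits are deterministic, so convergence in probability along any subsequence determines them;
  this is all that is kept of the almost sure convergence.\<close>

locale exceed_threshold =
  fixes f :: "ereal \<Rightarrow> real"
  assumes nonneg: "2 \<le> p \<Longrightarrow> 0 \<le> f p"
    and below: "2 \<le> p \<Longrightarrow> 0 \<le> t \<Longrightarrow> t < f p \<Longrightarrow> (\<lambda>n. exceed_prob n p t) \<longlonglongrightarrow> 1"
    and above: "2 \<le> p \<Longrightarrow> f p < t \<Longrightarrow> (\<lambda>n. exceed_prob n p t) \<longlonglongrightarrow> 0"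
begin

text \<open>At a level strictly between the two limits, a probability tending to 1 would be
  dominated by one tending to 0.\<close>

lemma antimono:
  assumes "2 \<le> p" "p \<le> q"
  shows "f q \<le> f p"
proof (rule ccontr)
  assume "\<not> f q \<le> f p"
  then obtain t where t: "f p < t" "t < f q" using dense[of "f p" "f q"] by auto
  have "(0::ereal) < 2" by simp
  then have p: "0 < p" "2 \<le> q" using less_le_trans[OF _ assms(1)] order.trans[OF assms] by blast+
  have t0: "0 \<le> t" using t nonneg[OF assms(1)] by simp
  have "exceed_prob n q t \<le> exceed_prob n p t" for n
  proof -
    interpret prob_space "gauss (idx n)" by (rule prob_space_gauss)
    show ?thesis unfolding exceed_prob_def
      by (rule finite_measure_mono[OF exceed_set_antimono[OF p(1) assms(2)] exceed_set_measurable])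
  qed
  then have "(1::real) \<le> 0"
    by (intro LIMSEQ_le[OF below[OF p(2) t0 t(2)] above[OF assms(1) t(1)]]) auto
  then show False by simp
qed

text \<open>The limit form of \<open>quad_form_truncation\<close>: by a union bound, its three
  exceptional events have probability tending to 0.\<close>

lemma truncation:
  assumes r: "2 \<le> r" "ereal r < q" and K: "K \<ge> 1"
  shows "f (ereal r) \<le> (K powr (1 - real_of_ereal (ereal r / q)))\<^sup>2 * f q
           + 3 * (f 2 + 1) * K powr ((2 - r) / 2)"
proof (rule ccontr)
  define \<kappa> where "\<kappa> = K powr (1 - real_of_ereal (ereal r / q))"
  define C where "C = f 2 + 1"
  define d where "d = 3 * C * K powr ((2 - r) / 2)"
  have r2: "2 \<le> ereal r" using r by simp
  then have q2: "2 \<le> q" using r by (meson less_imp_le order.trans)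
  have \<kappa>: "\<kappa> > 0" using K by (simp add: \<kappa>_def)
  have C: "C \<ge> 0" "f 2 < C" using nonneg[of 2] by (auto simp: C_def)
  have d: "d \<ge> 0" using C by (simp add: d_def)
  assume "\<not> f (ereal r) \<le> (K powr (1 - real_of_ereal (ereal r / q)))\<^sup>2 * f q
           + 3 * (f 2 + 1) * K powr ((2 - r) / 2)"
  then have less: "\<kappa>\<^sup>2 * f q + d < f (ereal r)" by (simp add: \<kappa>_def d_def C_def)
  \<comment> \<open>Chosen so that \<open>\<kappa>\<^sup>2 * t + d\<close> is the midpoint of
    \<open>\<kappa>\<^sup>2 * f q + d\<close> and \<open>f (ereal r)\<close>.\<close>
  define t where "t = f q + (f (ereal r) - (\<kappa>\<^sup>2 * f q + d)) / (2 * \<kappa>\<^sup>2)"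
  have t: "f q < t" using less \<kappa> by (simp add: t_def)
  have "\<kappa>\<^sup>2 * t = \<kappa>\<^sup>2 * f q + (f (ereal r) - (\<kappa>\<^sup>2 * f q + d)) / 2"
    using \<kappa> by (simp add: t_def field_simps)
  then have t1: "\<kappa>\<^sup>2 * t + d < f (ereal r)" using less by (simp add: field_simps)
  have t0: "0 \<le> \<kappa>\<^sup>2 * t + d" using nonneg[OF q2] t d by simp
  have "exceed_prob n (ereal r) (\<kappa>\<^sup>2 * t + d) \<le> exceed_prob n q t + exceed_prob n 2 C + exceed_prob n 2 C"
    if n: "n \<ge> 1" for n
  proof -
    interpret prob_space "gauss (idx n)" by (rule prob_space_gauss)
    let ?D = "{z \<in> space (gauss (idx n)). exceeds n 2 C (\<lambda>i j. - z (i, j))}"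
    note D = sets_exceeds_uminus[of n 2 C]
    have sub: "exceed_set n (ereal r) (\<kappa>\<^sup>2 * t + d) \<subseteq> (exceed_set n q t \<union> exceed_set n 2 C) \<union> ?D"
    proof
      fix z assume z: "z \<in> exceed_set n (ereal r) (\<kappa>\<^sup>2 * t + d)"
      then obtain y where y: "y \<in> normalized_ball n (ereal r)"
          "(\<kappa>\<^sup>2 * t + d) * real n powr (3/2) < quad_form n (curry z) y"
        unfolding exceed_set_def exceeds_def by blast
      show "z \<in> (exceed_set n q t \<union> exceed_set n 2 C) \<union> ?D"
      proof (rule ccontr)
        assume "\<not> ?thesis"
        then have "\<not> exceeds n q t (curry z)" "\<not> exceeds n 2 C (curry z)"
            "\<not> exceeds n 2 C (\<lambda>i j. - curry z i j)"
          using z by (auto simp: exceed_set_def)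
        from quad_form_truncation[OF n r K C(1) y(1), where G="curry z", OF this]
        show False using y(2) unfolding \<kappa>_def d_def by linarith
      qed
    qed
    have "prob (exceed_set n (ereal r) (\<kappa>\<^sup>2 * t + d)) \<le> prob ((exceed_set n q t \<union> exceed_set n 2 C) \<union> ?D)"
      by (intro finite_measure_mono sub sets.Un exceed_set_measurable D)
    also have "\<dots> \<le> prob (exceed_set n q t \<union> exceed_set n 2 C) + prob ?D"
      by (intro measure_Un_le sets.Un exceed_set_measurable D)
    also have "\<dots> \<le> prob (exceed_set n q t) + prob (exceed_set n 2 C) + prob ?D"
      by (intro add_right_mono measure_Un_le exceed_set_measurable)
    finally show ?thesis unfolding measure_exceeds_uminus by (simp add: exceed_prob_def)
  qed
  then have "(1::real) \<le> 0 + 0 + 0"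
    by (intro LIMSEQ_le[OF below[OF r2 t0 t1] tendsto_add[OF tendsto_add[OF above[OF q2 t]
          above[OF order.refl C(2)]] above[OF order.refl C(2)]]]) auto
  then show False by simp
qed

text \<open>Hadamard matrices are available for \<open>n = 2 ^ k\<close>, and this subsequence
  suffices: the exceedance probability for \<open>q\<close> would stay near or above a positive
  constant while tending to 0.\<close>

lemma flattening:
  fixes q \<eta> :: real
  assumes q: "2 \<le> q" "q \<le> 4" and \<eta>: "q - 2 < \<eta>"
  shows "f 2 \<le> (1 + \<eta>)\<^sup>2 * f (ereal q)"
proof (rule ccontr)
  have \<eta>0: "\<eta> > 0" using q \<eta> by simp
  assume "\<not> ?thesis"
  then obtain t where t: "(1 + \<eta>)\<^sup>2 * f (ereal q) < t" "t < f 2"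
    using dense[of "(1 + \<eta>)\<^sup>2 * f (ereal q)" "f 2"] by auto
  have q2: "2 \<le> ereal q" using q by simp
  have t0: "0 \<le> t"
    using t(1) nonneg[OF q2] by (smt (verit) mult_nonneg_nonneg zero_le_power2)
  have t': "f (ereal q) < t / (1 + \<eta>)\<^sup>2" using t(1) \<eta>0 by (simp add: field_simps)
  have pow: "strict_mono (\<lambda>k. 2 ^ k :: nat)" by (simp add: strict_mono_def)
  let ?c = "(\<eta> - (q - 2)) / (1 + \<eta>)"
  have "(\<lambda>k. ?c * exceed_prob (2 ^ k) 2 t) \<longlonglongrightarrow> ?c * 1"
    using LIMSEQ_subseq_LIMSEQ[OF below[OF order.refl t0 t(2)] pow]
    by (intro tendsto_mult_left) (simp add: comp_def)
  moreover have "(\<lambda>k. exceed_prob (2 ^ k) (ereal q) (t / (1 + \<eta>)\<^sup>2)) \<longlonglongrightarrow> 0"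
    using LIMSEQ_subseq_LIMSEQ[OF above[OF q2 t'] pow] by (simp add: comp_def)
  ultimately have "?c * 1 \<le> 0"
    by (rule LIMSEQ_le) (use exceed_prob_2_le[OF refl q \<eta>0] in auto)
  moreover have "?c > 0" using \<eta> \<eta>0 by simp
  ultimately show False by simp
qed

text \<open>Excludes a drop immediately to the right of \<open>r\<close>; as \<open>f\<close> is
  antitone, a single \<open>q\<close> is enough.\<close>

lemma right_approx:
  assumes r: "2 \<le> r" and e: "e > 0"
  shows "\<exists>q>ereal r. f (ereal r) < f q + e"
proof -
  define F where "F = f 2"
  have F: "F \<ge> 0" using nonneg[of 2] by (simp add: F_def)
  have le_F: "f q \<le> F" if "2 \<le> q" for q using antimono[OF order.refl that] by (simp add: F_def)
  show ?thesis
  proof (cases "r = 2")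
    case True
    \<comment> \<open>With \<open>\<eta>\<close> at most 1, the loss
      \<open>(2 * \<eta> + \<eta>\<^sup>2) * F\<close> is at most \<open>3 * \<eta> * F\<close>,
      which is below \<open>e\<close>.\<close>
    define \<eta> where "\<eta> = min 1 (e / (3 * F + 3))"
    define q where "q = 2 + \<eta> / 2"
    have "\<eta> \<le> e / (3 * F + 3)" by (simp add: \<eta>_def)
    then have "\<eta> * (3 * F + 3) \<le> e" using F by (simp add: pos_le_divide_eq)
    moreover have "0 < \<eta>" "\<eta> \<le> 1" using F e by (auto simp: \<eta>_def)
    ultimately have \<eta>: "0 < \<eta>" "\<eta> \<le> 1" "\<eta> * (3 * F + 3) \<le> e" by auto
    have q: "2 \<le> q" "q \<le> 4" "q - 2 < \<eta>" using \<eta> by (auto simp: q_def)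
    have "f 2 \<le> (1 + \<eta>)\<^sup>2 * f (ereal q)" by (rule flattening[OF q])
    also have "\<dots> = f (ereal q) + (2 * \<eta> + \<eta> * \<eta>) * f (ereal q)"
      by (simp add: power2_eq_square algebra_simps)
    also have "\<dots> \<le> f (ereal q) + (2 * \<eta> + \<eta> * 1) * F"
      using \<eta> q nonneg[of "ereal q"] le_F[of "ereal q"]
      by (intro add_left_mono mult_mono mult_left_mono) auto
    also have "\<dots> < f (ereal q) + e" using \<eta> by (simp add: algebra_simps)
    finally show ?thesis using True \<eta> by (intro exI[of _ "ereal q"]) (simp add: q_def)
  next
    case False
    with r have r: "r > 2" by simp
    \<comment> \<open>The order of choices matters: first \<open>K\<close> large makes the tail
      small, then \<open>s\<close> close to \<open>r\<close> brings
      \<open>K powr (1 - r / s)\<close> close to 1.\<close>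
    have L: "((\<lambda>K. 3 * (F + 1) * K powr ((2 - r) / 2)) \<longlongrightarrow> 3 * (F + 1) * 0) at_top"
      using r by (intro tendsto_intros tendsto_neg_powr filterlim_ident) auto
    have "\<forall>\<^sub>F K in at_top. 3 * (F + 1) * K powr ((2 - r) / 2) < e / 2"
      by (rule order_tendstoD(2)[OF L]) (use e in simp)
    then have "\<forall>\<^sub>F K in at_top. 1 \<le> K \<and> 3 * (F + 1) * K powr ((2 - r) / 2) < e / 2"
      using eventually_ge_at_top by (rule eventually_conj[rotated])
    then obtain K where K: "1 \<le> K" "3 * (F + 1) * K powr ((2 - r) / 2) < e / 2"
      using eventually_happens'[OF trivial_limit_at_top_linorder] by blast
    have L': "((\<lambda>s. ((K powr (1 - r / s))\<^sup>2 - 1) * F) \<longlongrightarrow> ((K powr (1 - r / r))\<^sup>2 - 1) * F) (at_right r)"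
      using K r by (intro tendsto_intros) auto
    have "\<forall>\<^sub>F s in at_right r. ((K powr (1 - r / s))\<^sup>2 - 1) * F < e / 2"
      by (rule order_tendstoD(2)[OF L']) (use e K r in simp)
    then have "\<forall>\<^sub>F s in at_right r. r < s \<and> ((K powr (1 - r / s))\<^sup>2 - 1) * F < e / 2"
      using eventually_at_right_less by (rule eventually_conj[rotated])
    then obtain s where s: "r < s" "((K powr (1 - r / s))\<^sup>2 - 1) * F < e / 2"
      using eventually_happens'[OF trivial_limit_at_right_real] by blast
    define \<kappa> where "\<kappa> = K powr (1 - r / s)"
    have "\<kappa> \<ge> 1" using K r s unfolding \<kappa>_def by (intro ge_one_powr_ge_zero) auto
    then have "(\<kappa>\<^sup>2 - 1) * f (ereal s) \<le> (\<kappa>\<^sup>2 - 1) * F"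
      using r s by (intro mult_left_mono le_F) auto
    moreover have "f (ereal r) \<le> \<kappa>\<^sup>2 * f (ereal s) + 3 * (F + 1) * K powr ((2 - r) / 2)"
      using truncation[of r "ereal s" K] r s K by (simp add: \<kappa>_def F_def)
    ultimately have "f (ereal r) < f (ereal s) + e"
      using K(2) s(2) unfolding \<kappa>_def[symmetric] by (simp add: algebra_simps)
    then show ?thesis using s by (intro exI[of _ "ereal s"]) simp
  qed
qed

text \<open>Excludes a drop on reaching \<open>p\<close> from the left, again by exhibiting one
  point.\<close>

lemma left_approx:
  assumes p: "2 < p" and e: "e > 0"
  shows "\<exists>q\<ge>2. q < p \<and> f q < f p + e"
proof -
  define F where "F = f 2"
  have F: "F \<ge> 0" using nonneg[of 2] by (simp add: F_def)
  have le_F: "f q \<le> F" if "2 \<le> q" for q using antimono[OF order.refl that] by (simp add: F_def)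
  show ?thesis
  proof (cases p)
    case (real s)
    with p have s: "s > 2" by simp
    \<comment> \<open>Here the truncated exponent \<open>r\<close> varies, so \<open>K\<close> is
      fixed for \<open>r0\<close>; the tail bound decreases in \<open>r\<close> and thus holds for
      all \<open>r\<close> above \<open>r0\<close>.\<close>
    define r0 where "r0 = (2 + s) / 2"
    have r0: "2 < r0" "r0 < s" using s by (auto simp: r0_def)
    have L: "((\<lambda>K. 3 * (F + 1) * K powr ((2 - r0) / 2)) \<longlongrightarrow> 3 * (F + 1) * 0) at_top"
      using r0 by (intro tendsto_intros tendsto_neg_powr filterlim_ident) auto
    have "\<forall>\<^sub>F K in at_top. 3 * (F + 1) * K powr ((2 - r0) / 2) < e / 2"
      by (rule order_tendstoD(2)[OF L]) (use e in simp)
    then have "\<forall>\<^sub>F K in at_top. 1 \<le> K \<and> 3 * (F + 1) * K powr ((2 - r0) / 2) < e / 2"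
      using eventually_ge_at_top by (rule eventually_conj[rotated])
    then obtain K where K: "1 \<le> K" "3 * (F + 1) * K powr ((2 - r0) / 2) < e / 2"
      using eventually_happens'[OF trivial_limit_at_top_linorder] by blast
    have L': "((\<lambda>r. ((K powr (1 - r / s))\<^sup>2 - 1) * F) \<longlongrightarrow> ((K powr (1 - s / s))\<^sup>2 - 1) * F) (at_left s)"
      using K s by (intro tendsto_intros) auto
    have "\<forall>\<^sub>F r in at_left s. ((K powr (1 - r / s))\<^sup>2 - 1) * F < e / 2"
      by (rule order_tendstoD(2)[OF L']) (use e K s in simp)
    moreover have "\<forall>\<^sub>F r in at_left s. r \<in> {r0<..<s}" using r0(2) by (rule eventually_at_left_real)
    ultimately have "\<forall>\<^sub>F r in at_left s. r \<in> {r0<..<s} \<and> ((K powr (1 - r / s))\<^sup>2 - 1) * F < e / 2"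
      by (rule eventually_conj[rotated])
    then obtain r where r: "r0 < r" "r < s" "((K powr (1 - r / s))\<^sup>2 - 1) * F < e / 2"
      using eventually_happens'[OF trivial_limit_at_left_real] by (auto simp: greaterThanLessThan_iff)
    define \<kappa> where "\<kappa> = K powr (1 - r / s)"
    have "\<kappa> \<ge> 1" using K r s unfolding \<kappa>_def by (intro ge_one_powr_ge_zero) auto
    then have "(\<kappa>\<^sup>2 - 1) * f (ereal s) \<le> (\<kappa>\<^sup>2 - 1) * F"
      using s by (intro mult_left_mono le_F) auto
    moreover have "f (ereal r) \<le> \<kappa>\<^sup>2 * f (ereal s) + 3 * (F + 1) * K powr ((2 - r) / 2)"
      using truncation[of r "ereal s" K] r0 r s K by (simp add: \<kappa>_def F_def)
    moreover have "3 * (F + 1) * K powr ((2 - r) / 2) \<le> 3 * (F + 1) * K powr ((2 - r0) / 2)"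
      using F K r by (intro mult_left_mono powr_mono) auto
    ultimately have "f (ereal r) < f (ereal s) + e"
      using K(2) r(3) unfolding \<kappa>_def[symmetric] by (simp add: algebra_simps)
    then show ?thesis using real r r0 by (intro exI[of _ "ereal r"]) simp
  next
    case PInf
    \<comment> \<open>For infinite \<open>p\<close> the dilation is \<open>K\<close> itself, so
      \<open>K = 1 + \<eta>\<close> has to be close to 1; the tail is made small by a large
      \<open>r\<close> instead.\<close>
    define \<eta> where "\<eta> = min 1 (e / (6 * F + 6))"
    have "\<eta> \<le> e / (6 * F + 6)" by (simp add: \<eta>_def)
    then have "\<eta> * (6 * F + 6) \<le> e" using F by (simp add: pos_le_divide_eq)
    moreover have "0 < \<eta>" "\<eta> \<le> 1" using F e by (auto simp: \<eta>_def)
    ultimately have \<eta>: "0 < \<eta>" "\<eta> \<le> 1" "\<eta> * (6 * F + 6) \<le> e" by auto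
    have "e / (6 * (F + 1)) > 0" using F e by simp
    then obtain m where m: "(1 / (1 + \<eta>)) ^ m < e / (6 * (F + 1))"
      using real_arch_pow_inv[of "e / (6 * (F + 1))" "1 / (1 + \<eta>)"] \<eta> by auto
    define r where "r = 2 + 2 * real m"
    have "(1 + \<eta>) powr (- real m) = (1 / (1 + \<eta>)) ^ m"
      using \<eta> by (simp add: powr_minus_divide powr_realpow power_one_over)
    moreover have "(2 - r) / 2 = - real m" by (simp add: r_def)
    ultimately have "(1 + \<eta>) powr ((2 - r) / 2) < e / (6 * (F + 1))" using m by simp
    then have small: "3 * (F + 1) * (1 + \<eta>) powr ((2 - r) / 2) < e / 2"
      using F by (simp add: pos_less_divide_eq algebra_simps)
    have "f (ereal r) \<le> (1 + \<eta>)\<^sup>2 * f \<infinity> + 3 * (F + 1) * (1 + \<eta>) powr ((2 - r) / 2)"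
      using truncation[of r "\<infinity>" "1 + \<eta>"] \<eta> by (simp add: r_def F_def)
    also have "(1 + \<eta>)\<^sup>2 * f \<infinity> = f \<infinity> + (2 * \<eta> + \<eta> * \<eta>) * f \<infinity>"
      by (simp add: power2_eq_square algebra_simps)
    also have "\<dots> \<le> f \<infinity> + (2 * \<eta> + \<eta> * 1) * F"
      using \<eta> nonneg[of \<infinity>] le_F[of \<infinity>] by (intro add_left_mono mult_mono mult_left_mono) auto
    also have "\<dots> \<le> f \<infinity> + e / 2" using \<eta> by (simp add: algebra_simps)
    finally have "f (ereal r) < f \<infinity> + e" using small by simp
    then show ?thesis using PInf by (intro exI[of _ "ereal r"]) (simp add: r_def)
  qed (use p in auto)
qed

lemma continuous: "continuous_on {2..\<infinity>} f"
  unfolding continuous_on_def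
proof (intro ballI tendstoI)
  fix p :: ereal and e :: real
  assume p: "p \<in> {2..\<infinity>}" and e: "0 < e"
  \<comment> \<open>By monotonicity one nearby point controls a whole ray: \<open>A\<close> gives
    the upper and \<open>B\<close> the lower estimate. At an end of the interval one of the two is
    trivial.\<close>
  obtain A where A: "open A" "p \<in> A" "\<And>x. x \<in> A \<Longrightarrow> 2 \<le> x \<Longrightarrow> f x < f p + e"
  proof (cases "p = 2")
    case True
    show ?thesis
    proof (rule that[of UNIV])
      fix x :: ereal assume "2 \<le> x"
      then have "f x \<le> f p" using True by (intro antimono) auto
      with e show "f x < f p + e" by simp
    qed auto
  next
    case False
    then have "2 < p" using p by (simp add: less_le)
    then obtain q where q: "2 \<le> q" "q < p" "f q < f p + e"
      using left_approx[OF \<open>2 < p\<close> e] by blast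
    show ?thesis
    proof (rule that[of "{q<..}"])
      fix x assume "x \<in> {q<..}"
      then have "f x \<le> f q" using q by (intro antimono) auto
      with q show "f x < f p + e" by simp
    qed (use q in auto)
  qed
  obtain B where B: "open B" "p \<in> B" "\<And>x. x \<in> B \<Longrightarrow> 2 \<le> x \<Longrightarrow> f p < f x + e"
  proof (cases p)
    case (real r)
    then obtain q where q: "p < q" "f p < f q + e"
      using right_approx[of r e] p e by auto
    show ?thesis
    proof (rule that[of "{..<q}"])
      fix x assume "x \<in> {..<q}" "2 \<le> x"
      then have "f q \<le> f x" by (intro antimono) auto
      with q show "f p < f x + e" by simp
    qed (use q in auto)
  next
    case PInf
    show ?thesis
    proof (rule that[of UNIV])
      fix x :: ereal assume "2 \<le> x"
      then have "f p \<le> f x" using PInf by (intro antimono) auto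
      with e show "f p < f x + e" by simp
    qed auto
  qed (use p in auto)
  show "\<forall>\<^sub>F x in at p within {2..\<infinity>}. dist (f x) (f p) < e"
    unfolding eventually_at_topological
  proof (intro exI[of _ "A \<inter> B"] conjI ballI impI)
    fix x assume "x \<in> A \<inter> B" "x \<in> {2..\<infinity>}"
    then show "dist (f x) (f p) < e" using A(3)[of x] B(3)[of x] by (simp add: dist_real_def abs_less_iff)
  qed (use A B in auto)
qed

end

section \<open>Transfer from the given probability space to the Gaussian law\<close>

lemma (in prob_space) prob_tendsto_of_AE_indicator:
  assumes "\<And>n. A n \<in> events" "AE \<omega> in M. (\<lambda>n. indicator (A n) \<omega> :: real) \<longlonglongrightarrow> c"
  shows "(\<lambda>n. prob (A n)) \<longlonglongrightarrow> c"
proof -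
  have "(\<lambda>n. \<integral>\<omega>. indicator (A n) \<omega> \<partial>M) \<longlonglongrightarrow> (\<integral>\<omega>. c \<partial>M)"
    by (rule integral_dominated_convergence[where w = "\<lambda>_. 1"]) (use assms in \<open>auto simp: indicator_def\<close>)
  moreover have "A n \<inter> space M = A n" for n using sets.sets_into_space[OF assms(1)] by blast
  ultimately show ?thesis by (simp add: prob_space)
qed

text \<open>Independence identifies the law of the entries indexed by \<open>idx n\<close> with
  \<open>gauss (idx n)\<close>, and the event depends on these entries only.\<close>

lemma (in prob_space) prob_exceeds:
  fixes g :: "nat \<Rightarrow> nat \<Rightarrow> 'a \<Rightarrow> real"
  assumes gaussian: "\<And>i j. 1 \<le> i \<Longrightarrow> 1 \<le> j \<Longrightarrow> distributed M lborel (g i j) std_normal_density"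
    and indep: "indep_vars (\<lambda>_. borel) (\<lambda>(i, j). g i j) ({1..} \<times> {1..})"
    and n: "n \<ge> 1"
  shows "{\<omega> \<in> space M. exceeds n p t (\<lambda>i j. g i j \<omega>)} \<in> events"
    and "prob {\<omega> \<in> space M. exceeds n p t (\<lambda>i j. g i j \<omega>)} = exceed_prob n p t"
proof -
  define X where "X q = (case q of (i, j) \<Rightarrow> g i j)" for q
  have law: "distr M borel (X q) = stdn" if "q \<in> idx n" for q
  proof -
    have "distributed M lborel (X q) std_normal_density"
      using that gaussian by (auto simp: X_def)
    then have "distr M lborel (X q) = stdn"
      by (simp add: stdn_def distributed_distr_eq_density)
    then show ?thesis by (simp cong: distr_cong)
  qed
  have rv [measurable]: "X q \<in> borel_measurable M" if "q \<in> idx n" for q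
    using distributed_measurable[OF gaussian] that by (auto simp: X_def)
  define Y where "Y \<omega> = (\<lambda>q\<in>idx n. X q \<omega>)" for \<omega>
  have Y: "Y \<in> measurable M (PiM (idx n) (\<lambda>_. borel))"
    unfolding Y_def by (intro measurable_restrict rv)
  then have Y': "Y \<in> measurable M (gauss (idx n))"
    using measurable_cong_sets[OF refl sets_gauss] by blast
  have "indep_vars (\<lambda>_. borel) X (idx n)"
    using indep_vars_subset[OF indep, of "idx n"] by (simp add: X_def[abs_def] Sigma_mono)
  then have "distr M (PiM (idx n) (\<lambda>_. borel)) Y = PiM (idx n) (\<lambda>q. distr M borel (X q))"
    unfolding Y_def using n by (subst (asm) indep_vars_iff_distr_eq_PiM') (auto intro: rv)
  also have "\<dots> = gauss (idx n)"
    unfolding gauss_def by (intro PiM_cong refl law)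
  finally have D: "distr M (gauss (idx n)) Y = gauss (idx n)"
    by (metis distr_cong sets_gauss)
  have "exceeds n p t (curry (Y \<omega>)) \<longleftrightarrow> exceeds n p t (\<lambda>i j. g i j \<omega>)" for \<omega>
    by (rule exceeds_cong) (simp add: Y_def X_def)
  then have eq: "{\<omega> \<in> space M. exceeds n p t (\<lambda>i j. g i j \<omega>)} = Y -` exceed_set n p t \<inter> space M"
    using measurable_space[OF Y'] by (auto simp: exceed_set_def)
  show "{\<omega> \<in> space M. exceeds n p t (\<lambda>i j. g i j \<omega>)} \<in> events"
    unfolding eq by (rule measurable_sets[OF Y' exceed_set_measurable])
  show "prob {\<omega> \<in> space M. exceeds n p t (\<lambda>i j. g i j \<omega>)} = exceed_prob n p t"
    unfolding eq exceed_prob_def using measure_distr[OF Y' exceed_set_measurable] D by simp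
qed

text \<open>The density is positive everywhere, so otherwise the interval from 0 to 1 would be
  Lebesgue null. This is used to see that the limits are nonnegative.\<close>

lemma (in prob_space) prob_std_normal_pos:
  assumes "distributed M lborel X std_normal_density"
  shows "\<not> (AE \<omega> in M. X \<omega> \<le> 0)"
proof
  assume "AE \<omega> in M. X \<omega> \<le> 0"
  then have "AE x in density lborel (\<lambda>x. ennreal (std_normal_density x)). x \<le> 0"
    unfolding distributed_distr_eq_density[OF assms, symmetric]
    using distributed_measurable[OF assms] by (subst AE_distr_iff) auto
  then have neg: "AE x in lborel. x \<le> (0::real)"
    by (subst (asm) AE_density) (auto simp: normal_density_pos)
  have "emeasure lborel {0<..(1::real)} = emeasure lborel ({} :: real set)"
  proof (rule emeasure_eq_AE)
    show "AE x in lborel. x \<in> {0<..(1::real)} \<longleftrightarrow> x \<in> {}"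
      using neg by eventually_elim auto
  qed auto
  then show False by simp
qed

theorem theorem1p7:
  fixes M :: "'a measure"
    and g :: "nat \<Rightarrow> nat \<Rightarrow> 'a \<Rightarrow> real"
    and GP :: "ereal \<Rightarrow> real"
  assumes "prob_space M"
    and gaussian: "\<And>i j. 1 \<le> i \<Longrightarrow> 1 \<le> j \<Longrightarrow> distributed M lborel (g i j) std_normal_density"
    and indep: "prob_space.indep_vars M (\<lambda>_. borel) (\<lambda>(i, j). g i j) ({1..} \<times> {1..})"
    and GP_limit: "\<And>p. 2 \<le> p \<Longrightarrow>
      AE \<omega> in M. (\<lambda>n. GP_np (\<lambda>i j. g i j \<omega>) n p) \<longlonglongrightarrow> GP p"
  shows "continuous_on {2..\<infinity>} GP"
proof -
  interpret prob_space M by fact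
  define A where "A p t n = {\<omega> \<in> space M. exceeds n p t (\<lambda>i j. g i j \<omega>)}" for p t n
  have A: "A p t n \<in> events" "prob (A p t n) = exceed_prob n p t" if "n \<ge> 1" for p t n
    unfolding A_def
    by (rule prob_exceeds(1)[OF _ indep that], rule gaussian, assumption+)
       (rule prob_exceeds(2)[OF _ indep that], rule gaussian)
  have A_iff: "\<omega> \<in> A p t n \<longleftrightarrow> t < GP_np (\<lambda>i j. g i j \<omega>) n p"
    if "n \<ge> 1" "2 \<le> p" "0 \<le> t" "\<omega> \<in> space M" for \<omega> p t n
    using less_GP_np_iff[OF that(1-3)] that(4) by (simp add: A_def)
  \<comment> \<open>The index is shifted by one because the link with the given matrix is available
    for \<open>n \<ge> 1\<close> only.\<close>
  have lim: "(\<lambda>n. exceed_prob n p t) \<longlonglongrightarrow> c"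
    if "AE \<omega> in M. \<forall>\<^sub>F n in sequentially. n \<ge> 1 \<longrightarrow> indicator (A p t n) \<omega> = c" for p t c
  proof -
    have "(\<lambda>n. prob (A p t (Suc n))) \<longlonglongrightarrow> c"
    proof (rule prob_tendsto_of_AE_indicator)
      show "A p t (Suc n) \<in> events" for n by (rule A) simp
      from that show "AE \<omega> in M. (\<lambda>n. indicator (A p t (Suc n)) \<omega> :: real) \<longlonglongrightarrow> c"
      proof eventually_elim
        case (elim \<omega>)
        then have "\<forall>\<^sub>F n in sequentially. indicator (A p t (Suc n)) \<omega> = c"
          by (subst (asm) eventually_sequentially_Suc[symmetric]) simp
        then show ?case by (rule tendsto_eventually)
      qed
    qed
    then have "(\<lambda>n. exceed_prob (Suc n) p t) \<longlonglongrightarrow> c" by (simp add: A)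
    then show ?thesis by (rule LIMSEQ_imp_Suc)
  qed
  \<comment> \<open>The first unit vector shows that \<open>GP_np\<close> is positive whenever
    \<open>g 1 1\<close> is. A negative limit would thus force \<open>g 1 1\<close> to be almost
    surely at most 0.\<close>
  have nonneg: "0 \<le> GP p" if p: "2 \<le> p" for p
  proof (rule ccontr)
    assume neg: "\<not> 0 \<le> GP p"
    from GP_limit[OF p] AE_space have "AE \<omega> in M. g 1 1 \<omega> \<le> 0"
    proof eventually_elim
      case (elim \<omega>)
      have "\<forall>\<^sub>F n in sequentially. GP_np (\<lambda>i j. g i j \<omega>) n p < 0"
        using elim(1) neg by (intro order_tendstoD(2)) auto
      then have "\<forall>\<^sub>F n in sequentially. 1 \<le> n \<and> GP_np (\<lambda>i j. g i j \<omega>) n p < 0"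
        using eventually_ge_at_top by (rule eventually_conj[rotated])
      then obtain n where n: "1 \<le> n" "GP_np (\<lambda>i j. g i j \<omega>) n p < 0"
        using eventually_happens'[OF trivial_limit_sequentially] by blast
      show "g 1 1 \<omega> \<le> 0"
      proof (rule ccontr)
        assume "\<not> g 1 1 \<omega> \<le> 0"
        define y where "y i = (if i = 1 then 1 else 0 :: real)" for i :: nat
        have "lp_norm n p y = 1" unfolding y_def by (rule lp_norm_unit_vector[OF n(1) p])
        moreover have "1 \<le> real n powr (real_of_ereal (2 / p) / 2)"
          using n(1) p by (cases p) (auto intro!: ge_one_powr_ge_zero)
        ultimately have "y \<in> normalized_ball n p"
          by (simp add: normalized_ball_iff_lp_norm[OF n(1) p])
        moreover have "quad_form n (\<lambda>i j. g i j \<omega>) y = g 1 1 \<omega>"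
          using n(1) by (simp add: quad_form_def y_def if_distrib[of "\<lambda>x. _ * x"] cong: if_cong)
        ultimately have "exceeds n p 0 (\<lambda>i j. g i j \<omega>)"
          unfolding exceeds_def using \<open>\<not> g 1 1 \<omega> \<le> 0\<close> by (intro bexI[of _ y]) auto
        then show False using less_GP_np_iff[OF n(1) p order.refl, of "\<lambda>i j. g i j \<omega>"] n(2) by linarith
      qed
    qed
    then show False using prob_std_normal_pos[OF gaussian[of 1 1]] by simp
  qed
  interpret exceed_threshold GP
  proof
    fix p t assume p: "2 \<le> p" and t: "0 \<le> t" "t < GP p"
    from GP_limit[OF p] AE_space
    have "AE \<omega> in M. \<forall>\<^sub>F n in sequentially. n \<ge> 1 \<longrightarrow> indicator (A p t n) \<omega> = (1::real)"
    proof eventually_elim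
      case (elim \<omega>)
      show ?case using order_tendstoD(1)[OF elim(1) t(2)]
        by eventually_elim (simp add: indicator_def A_iff[OF _ p t(1) elim(2)])
    qed
    then show "(\<lambda>n. exceed_prob n p t) \<longlonglongrightarrow> 1" by (rule lim)
  next
    fix p t assume p: "2 \<le> p" and t: "GP p < t"
    then have t0: "0 \<le> t" using nonneg[OF p] by simp
    from GP_limit[OF p] AE_space
    have "AE \<omega> in M. \<forall>\<^sub>F n in sequentially. n \<ge> 1 \<longrightarrow> indicator (A p t n) \<omega> = (0::real)"
    proof eventually_elim
      case (elim \<omega>)
      show ?case using order_tendstoD(2)[OF elim(1) t]
        by eventually_elim (simp add: indicator_def A_iff[OF _ p t0 elim(2)])
    qed
    then show "(\<lambda>n. exceed_prob n p t) \<longlonglongrightarrow> 0" by (rule lim)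
  qed (rule nonneg)
  show ?thesis by (rule continuous)
qed

end
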